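(* Let $e_0,e_3,e_4\in\mathbb{C}^*$ satisfy $e_0\neq\pm1$, $e_3\neq\pm1$, $e_4\neq\pm1$ and $e_0e_3^{\varepsilon_3}e_4^{\varepsilon_4}\neq1$ for all $\varepsilon_3,\varepsilon_4\in\{1,-1\}$. For $\kappa\in\mathbb{C}^*$, the family of birational dynamics $g_{2,3}(\kappa)=\Phi_\kappa^{-1}\circ h_{2,3}\circ\Phi_\kappa$ on the cubic surface $\mathcal{C}_V(\theta)$ is defined by $(x_1,x_2,x_3)\mapsto(X_1,X_2,X_3)$ with $$X_1=\frac{e_0}{x_2},\qquad X_2=x_2-\frac{\kappa^2}{x_2}+e_0^{-1}\kappa^2x_1,$$ $$X_3=\kappa^{-2}x_2^2x_3-(e_0^{-2}\kappa^2-\kappa^{-2})x_1x_2-2e_0^{-1}x_2^2+(e_0^{-1}\theta_2-\kappa^{-2}\theta_1)x_2+(e_0^{-1}\kappa^2+e_0\kappa^{-2}).$$ The second family $g_{3,1}(\kappa)=\Phi_\kappa^{-1}\circ h_{3,1}\circ\Phi_\kappa$ is given by $g_{1,3}(\kappa)=g_{1,2}\circ g_{2,3}(\kappa)$, where $g_{1,3}(\kappa)=g_{3,1}(\kappa)^{-1}$ and $g_{1,2}=\Phi_\kappa^{-1}\circ h_{1,2}\circ\Phi_\kappa$ (which does not depend on $\kappa$).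
   Context: $a_3=e_3+e_3^{-1}$, $a_4=e_4+e_4^{-1}$, $\theta_1=a_3+e_0a_4$, $\theta_2=a_4+e_0a_3$, $\theta_3=e_0$, $\theta_4=e_0^2+e_0a_3a_4+1$; $\mathcal{C}_V(\theta)\subset\mathbb{C}^3$ is the surface $x_1x_2x_3+x_1^2+x_2^2-\theta_1x_1-\theta_2x_2-\theta_3x_3+\theta_4=0$. For $\kappa\in\mathbb{C}^*$ put $b_1=\kappa+\kappa^{-1}$, $b_2=e_0\kappa^{-1}+e_0^{-1}\kappa$, $b_3=a_3$, $b_4=a_4$, $\Theta_i=b_ib_4+b_jb_k$ for $\{i,j,k\}=\{1,2,3\}$, $\Theta_4=b_1b_2b_3b_4+\sum_{i=1}^4b_i^2-4$; $\mathcal{C}_{VI}(\theta_\kappa)\subset\mathbb{C}^3$ is the surface $x_1x_2x_3+x_1^2+x_2^2+x_3^2-\Theta_1x_1-\Theta_2x_2-\Theta_3x_3+\Theta_4=0$. $\Phi_\kappa:\mathcal{C}_V(\theta)\to\mathcal{C}_{VI}(\theta_\kappa)$ is the birational map $$(x_1,x_2,x_3)\mapsto\big(e_0^{-1}\kappa x_1+\kappa^{-1}x_2,\; -e_0^{-1}\kappa x_1x_3+\kappa^{-1}x_1-e_0^{-1}\kappa x_2+a_3\kappa+a_4e_0^{-1}\kappa,\; x_3\big).$$ The braid dynamics on $\mathcal{C}_{VI}(\theta_\kappa)$: for $(i,j,k)=(1,2,3)$, $(2,3,1)$ or $(3,1,2)$, $h_{i,j}$ is the automorphism $$x_i\mapsto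 -x_i+x_jx_k+x_ix_k^2-\Theta_jx_k+\Theta_i,\qquad x_j\mapsto -x_j-x_ix_k+\Theta_j,\qquad x_k\mapsto x_k,$$ giving the action of the elementary pure braid $b_{i,j}$; the three generating braids satisfy $b_{1,2}\cdot b_{2,3}\cdot b_{3,1}=1$.
   Formalization: With the displayed h_{2,3} and ordinary composition, the formula (X_1,X_2,X_3) is not g_{2,3}(κ) but its inverse (fails at e_0=2, e_3=3, e_4=5, κ=1, x=(1,1,241/15)); the formal theorem states it for g_{2,3}(κ)^{-1}, the rest is literal. *)

theory Defs
  imports "HOL-Analysis.Analysis"
begin

section \<open>Rational maps between closed algebraic subsets of affine space\<close>

inductive polyfun :: "(complex^'n \<Rightarrow> complex) \<Rightarrow> bool" where
  polyfun_const: "polyfun (\<lambda>x. c)"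
| polyfun_coord: "polyfun (\<lambda>x. x $ i)"
| polyfun_add: "polyfun p \<Longrightarrow> polyfun q \<Longrightarrow> polyfun (\<lambda>x. p x + q x)"
| polyfun_mult: "polyfun p \<Longrightarrow> polyfun q \<Longrightarrow> polyfun (\<lambda>x. p x * q x)"

definition zariski_open_in :: "(complex^'n) set \<Rightarrow> (complex^'n) set \<Rightarrow> bool" where
  "zariski_open_in X U \<longleftrightarrow>
     (\<exists>P. (\<forall>p\<in>P. polyfun p) \<and> U = {x \<in> X. \<exists>p\<in>P. p x \<noteq> 0})"

definition zariski_dense_open :: "(complex^'n) set \<Rightarrow> (complex^'n) set \<Rightarrow> bool" where
  "zariski_dense_open X U \<longleftrightarrow> zariski_open_in X U \<and>
     (\<forall>V. zariski_open_in X V \<and> V \<noteq> {} \<longrightarrow> U \<inter> V \<noteq> {})"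

text \<open>\<open>{y \<in> U. q y \<noteq> 0}\<close> is the Zariski neighbourhood of \<open>x\<close> in \<open>U\<close> on which the function is
  a quotient of polynomials.\<close>

definition regular_on :: "(complex^'n) set \<Rightarrow> (complex^'n \<Rightarrow> complex) \<Rightarrow> bool" where
  "regular_on U f \<longleftrightarrow>
     (\<forall>x\<in>U. \<exists>p q. polyfun p \<and> polyfun q \<and> q x \<noteq> 0 \<and>
        (\<forall>y\<in>U. q y \<noteq> 0 \<longrightarrow> f y = p y / q y))"

text \<open>A rational map from \<open>X\<close> to \<open>Y\<close> is represented by a partial function that is defined and
  regular on a dense Zariski open subset of \<open>X\<close>. Two representatives define the same rational map
  iff they are related by \<open>rational_eq X\<close>. Composition of representatives is composition of partial
  functions \<open>f \<circ>\<^sub>m g\<close> (first \<open>g\<close>), defined on the points of \<open>dom g\<close> that \<open>g\<close> sends into \<open>dom f\<close>.\<close>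

definition rational_map ::
  "(complex^'n) set \<Rightarrow> (complex^'m) set \<Rightarrow> (complex^'n \<rightharpoonup> complex^'m) \<Rightarrow> bool" where
  "rational_map X Y f \<longleftrightarrow> zariski_dense_open X (dom f) \<and> ran f \<subseteq> Y \<and>
     (\<forall>i. regular_on (dom f) (\<lambda>x. the (f x) $ i))"

definition rational_eq ::
  "(complex^'n) set \<Rightarrow> (complex^'n \<rightharpoonup> complex^'m) \<Rightarrow> (complex^'n \<rightharpoonup> complex^'m) \<Rightarrow> bool" where
  "rational_eq X f g \<longleftrightarrow>
     (\<exists>U. zariski_dense_open X U \<and> U \<subseteq> dom f \<inter> dom g \<and> (\<forall>x\<in>U. f x = g x))"

definition total_on :: "(complex^'n) set \<Rightarrow> (complex^'n \<Rightarrow> complex^'m) \<Rightarrow> (complex^'n \<rightharpoonup> complex^'m)" where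
  "total_on X F = (\<lambda>x. if x \<in> X then Some (F x) else None)"

definition rational_inverse ::
  "(complex^'n) set \<Rightarrow> (complex^'m) set \<Rightarrow> (complex^'n \<rightharpoonup> complex^'m) \<Rightarrow> (complex^'m \<rightharpoonup> complex^'n) \<Rightarrow> bool"
  where
  "rational_inverse X Y f g \<longleftrightarrow> rational_map X Y f \<and> rational_map Y X g \<and>
     rational_eq X (g \<circ>\<^sub>m f) (total_on X (\<lambda>x. x)) \<and>
     rational_eq Y (f \<circ>\<^sub>m g) (total_on Y (\<lambda>y. y))"

definition birational_map ::
  "(complex^'n) set \<Rightarrow> (complex^'m) set \<Rightarrow> (complex^'n \<rightharpoonup> complex^'m) \<Rightarrow> bool" where
  "birational_map X Y f \<longleftrightarrow> (\<exists>g. rational_inverse X Y f g)"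

text \<open>A representative of the inverse rational map; meaningful only if \<open>f\<close> is birational, and then
  determined up to \<open>rational_eq Y\<close>.\<close>

definition rat_inv ::
  "(complex^'n) set \<Rightarrow> (complex^'m) set \<Rightarrow> (complex^'n \<rightharpoonup> complex^'m) \<Rightarrow> (complex^'m \<rightharpoonup> complex^'n)" where
  "rat_inv X Y f = (SOME g. rational_inverse X Y f g)"


section \<open>The cubic surfaces\<close>

definition tr :: "complex \<Rightarrow> complex" where
  "tr e = e + inverse e"

definition theta :: "complex \<Rightarrow> complex \<Rightarrow> complex \<Rightarrow> complex^4" where
  "theta e0 e3 e4 = (let a3 = tr e3; a4 = tr e4 in
     vector [a3 + e0 * a4, a4 + e0 * a3, e0, e0^2 + e0 * a3 * a4 + 1])"

definition cubic_V :: "complex \<Rightarrow> complex \<Rightarrow> complex \<Rightarrow> (complex^3) set" where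
  "cubic_V e0 e3 e4 = (let \<theta> = theta e0 e3 e4 in
     {x. x$1 * x$2 * x$3 + (x$1)^2 + (x$2)^2
         - \<theta>$1 * x$1 - \<theta>$2 * x$2 - \<theta>$3 * x$3 + \<theta>$4 = 0})"

definition b_VI :: "complex \<Rightarrow> complex \<Rightarrow> complex \<Rightarrow> complex \<Rightarrow> complex^4" where
  "b_VI e0 e3 e4 \<kappa> =
     vector [\<kappa> + inverse \<kappa>, e0 * inverse \<kappa> + inverse e0 * \<kappa>, tr e3, tr e4]"

definition Theta :: "complex \<Rightarrow> complex \<Rightarrow> complex \<Rightarrow> complex \<Rightarrow> complex^3" where
  "Theta e0 e3 e4 \<kappa> = (let b = b_VI e0 e3 e4 \<kappa> in
     vector [b$1 * b$4 + b$2 * b$3, b$2 * b$4 + b$3 * b$1, b$3 * b$4 + b$1 * b$2])"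

definition Theta4 :: "complex \<Rightarrow> complex \<Rightarrow> complex \<Rightarrow> complex \<Rightarrow> complex" where
  "Theta4 e0 e3 e4 \<kappa> = (let b = b_VI e0 e3 e4 \<kappa> in
     b$1 * b$2 * b$3 * b$4 + (\<Sum>i\<in>UNIV. (b$i)^2) - 4)"

definition cubic_VI :: "complex \<Rightarrow> complex \<Rightarrow> complex \<Rightarrow> complex \<Rightarrow> (complex^3) set" where
  "cubic_VI e0 e3 e4 \<kappa> = (let \<Theta> = Theta e0 e3 e4 \<kappa> in
     {x. x$1 * x$2 * x$3 + (x$1)^2 + (x$2)^2 + (x$3)^2
         - \<Theta>$1 * x$1 - \<Theta>$2 * x$2 - \<Theta>$3 * x$3 + Theta4 e0 e3 e4 \<kappa> = 0})"


section \<open>The birational map and the dynamics\<close>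

definition Phi_map :: "complex \<Rightarrow> complex \<Rightarrow> complex \<Rightarrow> complex \<Rightarrow> complex^3 \<Rightarrow> complex^3" where
  "Phi_map e0 e3 e4 \<kappa> x = vector
     [inverse e0 * \<kappa> * x$1 + inverse \<kappa> * x$2,
      - (inverse e0 * \<kappa> * x$1 * x$3) + inverse \<kappa> * x$1 - inverse e0 * \<kappa> * x$2
        + tr e3 * \<kappa> + tr e4 * inverse e0 * \<kappa>,
      x$3]"

definition Phi :: "complex \<Rightarrow> complex \<Rightarrow> complex \<Rightarrow> complex \<Rightarrow> (complex^3 \<rightharpoonup> complex^3)" where
  "Phi e0 e3 e4 \<kappa> = total_on (cubic_V e0 e3 e4) (Phi_map e0 e3 e4 \<kappa>)"

text \<open>The indices \<open>(i, j, k)\<close> below are meant to be \<open>(1, 2, 3)\<close>, \<open>(2, 3, 1)\<close> or \<open>(3, 1, 2)\<close>;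
  the corresponding maps are usually labelled by \<open>i, j\<close> only.\<close>

definition h_map ::
  "complex \<Rightarrow> complex \<Rightarrow> complex \<Rightarrow> complex \<Rightarrow> 3 \<Rightarrow> 3 \<Rightarrow> 3 \<Rightarrow> complex^3 \<Rightarrow> complex^3" where
  "h_map e0 e3 e4 \<kappa> i j k x = (let \<Theta> = Theta e0 e3 e4 \<kappa> in
     (\<chi> l. if l = i then - x$i + x$j * x$k + x$i * (x$k)^2 - \<Theta>$j * x$k + \<Theta>$i
          else if l = j then - x$j - x$i * x$k + \<Theta>$j
          else x$l))"

definition h_VI :: "complex \<Rightarrow> complex \<Rightarrow> complex \<Rightarrow> complex \<Rightarrow> 3 \<Rightarrow> 3 \<Rightarrow> 3 \<Rightarrow> (complex^3 \<rightharpoonup> complex^3)" where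
  "h_VI e0 e3 e4 \<kappa> i j k = total_on (cubic_VI e0 e3 e4 \<kappa>) (h_map e0 e3 e4 \<kappa> i j k)"

definition g_V :: "complex \<Rightarrow> complex \<Rightarrow> complex \<Rightarrow> complex \<Rightarrow> 3 \<Rightarrow> 3 \<Rightarrow> 3 \<Rightarrow> (complex^3 \<rightharpoonup> complex^3)" where
  "g_V e0 e3 e4 \<kappa> i j k =
     rat_inv (cubic_V e0 e3 e4) (cubic_VI e0 e3 e4 \<kappa>) (Phi e0 e3 e4 \<kappa>)
       \<circ>\<^sub>m h_VI e0 e3 e4 \<kappa> i j k \<circ>\<^sub>m Phi e0 e3 e4 \<kappa>"

definition X_map :: "complex \<Rightarrow> complex \<Rightarrow> complex \<Rightarrow> complex \<Rightarrow> complex^3 \<Rightarrow> complex^3" where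
  "X_map e0 e3 e4 \<kappa> x = (let \<theta> = theta e0 e3 e4 in vector
     [e0 / x$2,
      x$2 - \<kappa>^2 / x$2 + inverse e0 * \<kappa>^2 * x$1,
      inverse (\<kappa>^2) * (x$2)^2 * x$3 - (inverse (e0^2) * \<kappa>^2 - inverse (\<kappa>^2)) * x$1 * x$2
        - 2 * inverse e0 * (x$2)^2 + (inverse e0 * \<theta>$2 - inverse (\<kappa>^2) * \<theta>$1) * x$2
        + (inverse e0 * \<kappa>^2 + e0 * inverse (\<kappa>^2))])"

definition X_rat :: "complex \<Rightarrow> complex \<Rightarrow> complex \<Rightarrow> complex \<Rightarrow> (complex^3 \<rightharpoonup> complex^3)" where
  "X_rat e0 e3 e4 \<kappa> = total_on {x \<in> cubic_V e0 e3 e4. x$2 \<noteq> 0} (X_map e0 e3 e4 \<kappa>)"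

text \<open>With \<open>g_V\<close> as above (point maps, composed from right to left), \<open>X_rat e0 e3 e4 \<kappa>\<close> is the
  conjugate by \<open>Phi\<close> of the inverse of \<open>h_VI\<close> at indices \<open>(2, 3, 1)\<close>, so it represents the inverse of
  \<open>g_V e0 e3 e4 \<kappa> 2 3 1\<close> and not that map itself. For example, for \<open>e0 = 2\<close>, \<open>e3 = 3\<close>, \<open>e4 = 5\<close>,
  \<open>\<kappa> = 1\<close> the point \<open>(1, 1, 241/15)\<close> of \<open>cubic_V\<close> goes to \<open>(-1, 2, 26/3)\<close> under the conjugate of
  the map with indices \<open>(2, 3, 1)\<close>, and to \<open>(2, 1/2, 631/60)\<close> under \<open>X_rat\<close>.\<close>

end

theory Submission
  imports Defs
begin

text \<open>Each braid map of the surface \<open>cubic_VI\<close> is a product of two Vieta involutions: the equation is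
  a monic quadratic in each coordinate, and \<open>vieta\<close> replaces one coordinate by the other root. If
  \<open>s\<^sub>i\<close> changes the coordinate \<open>i\<close>, then \<open>h\<^sub>1\<^sub>2 = s\<^sub>1 s\<^sub>2\<close>, \<open>h\<^sub>2\<^sub>3 = s\<^sub>2 s\<^sub>3\<close> and
  \<open>h\<^sub>3\<^sub>1 = s\<^sub>3 s\<^sub>1\<close>, so the inverses are evident and the braid relation
  \<open>h\<^sub>1\<^sub>2 h\<^sub>2\<^sub>3 = h\<^sub>3\<^sub>1\<^sup>-\<^sup>1\<close> is a cancellation. Everything else is transported along \<open>Phi\<close>.

  For fixed \<open>x\<^sub>3\<close> the first two coordinates of \<open>Phi\<close> are affine in \<open>x\<^sub>1, x\<^sub>2\<close>, with a determinant that is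
  affine in \<open>x\<^sub>3\<close> and vanishes exactly for \<open>x\<^sub>3 = degenerate_x3\<close>. The equation of \<open>cubic_VI\<close> pulls back to minus that
  determinant times the equation of \<open>cubic_V\<close> (\<open>Phi_cubic_identity\<close>). Hence \<open>Phi\<close> is an
  isomorphism between the two surfaces without the sections \<open>x\<^sub>3 = degenerate_x3\<close>, and a
  birational map once these complements are known to be dense.

  To identify a conjugate \<open>Phi\<^sup>-\<^sup>1 h Phi\<close> with an explicit map \<open>F\<close> it is enough to check that
  \<open>Phi F = h Phi\<close> and that \<open>F\<close> preserves \<open>cubic_V\<close> (\<open>conjugate_Phi_eqI\<close>). Both are
  identities of rational functions modulo the equation of \<open>cubic_V\<close>. For \<open>h = s\<^sub>3 s\<^sub>2\<close> the map \<open>F\<close> is \<open>X_map\<close>, and for \<open>h = h\<^sub>1\<^sub>2\<close> it is the product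
  of the two Vieta involutions of \<open>cubic_V\<close> itself, which does not involve \<open>\<kappa>\<close>.

  Density comes from the Euclidean topology. A Zariski open set is open for that topology too, so it
  suffices to approximate points of the surface by points off the section \<open>x\<^sub>k = c\<close>; as the equation
  is monic in another coordinate, one perturbs \<open>x\<^sub>k\<close> and follows a root.

  The inverse of a rational map is only determined up to \<open>rational_eq\<close>, so all this rests on a
  calculus of that relation: dense open sets pull back to dense open sets along a map that has a
  rational inverse (\<open>zariski_dense_open_map_preimage\<close>), therefore such maps can be composed, their
  inverses are unique, and composition respects \<open>rational_eq\<close>.\<close>

section \<open>Zariski open sets and regular functions\<close>

lemma polyfun_continuous: "polyfun p \<Longrightarrow> continuous_on UNIV p"
  by (induction rule: polyfun.induct) (auto intro!: continuous_intros)

lemma zariski_open_in_subset: "zariski_open_in X U \<Longrightarrow> U \<subseteq> X"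
  by (auto simp: zariski_open_in_def)

lemma zariski_open_in_self: "zariski_open_in X X"
  unfolding zariski_open_in_def
  by (rule exI[of _ "{\<lambda>x. 1}"]) (auto intro: polyfun_const)

lemma zariski_open_in_Int:
  assumes "zariski_open_in X U" and "zariski_open_in X V"
  shows "zariski_open_in X (U \<inter> V)"
proof -
  from assms obtain P Q where
    P: "\<forall>p\<in>P. polyfun p" "U = {x \<in> X. \<exists>p\<in>P. p x \<noteq> 0}" and
    Q: "\<forall>q\<in>Q. polyfun q" "V = {x \<in> X. \<exists>q\<in>Q. q x \<noteq> 0}"
    unfolding zariski_open_in_def by blast
  let ?R = "{\<lambda>x. p x * q x |p q. p \<in> P \<and> q \<in> Q}"
  have "\<forall>r\<in>?R. polyfun r"
    using P(1) Q(1) by (auto intro: polyfun_mult)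
  moreover have "U \<inter> V = {x \<in> X. \<exists>r\<in>?R. r x \<noteq> 0}"
    using P(2) Q(2) by fastforce
  ultimately show ?thesis
    unfolding zariski_open_in_def by blast
qed

text \<open>A union is cut out by all polynomials whose nonvanishing locus lies inside it, which avoids a
  choice of defining polynomials for each member.\<close>

lemma zariski_open_in_Union:
  assumes "\<And>U. U \<in> \<U> \<Longrightarrow> zariski_open_in X U"
  shows "zariski_open_in X (\<Union>\<U>)"
proof -
  define P where "P = {p. polyfun p \<and> {x \<in> X. p x \<noteq> 0} \<subseteq> \<Union>\<U>}"
  have "\<Union>\<U> \<subseteq> {x \<in> X. \<exists>p\<in>P. p x \<noteq> 0}"
  proof
    fix x assume "x \<in> \<Union>\<U>"
    then obtain U where U: "U \<in> \<U>" "x \<in> U" by blast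
    from assms[OF U(1)] obtain Q
      where Q: "\<forall>q\<in>Q. polyfun q" "U = {x \<in> X. \<exists>q\<in>Q. q x \<noteq> 0}"
      unfolding zariski_open_in_def by blast
    then obtain q where q: "q \<in> Q" "q x \<noteq> 0" "x \<in> X"
      using U(2) by auto
    moreover have "{x \<in> X. q x \<noteq> 0} \<subseteq> U"
      using Q(2) q(1) by auto
    then have "q \<in> P"
      using Q(1) q(1) U(1) by (auto simp: P_def)
    ultimately show "x \<in> {x \<in> X. \<exists>p\<in>P. p x \<noteq> 0}"
      by blast
  qed
  then have "\<Union>\<U> = {x \<in> X. \<exists>p\<in>P. p x \<noteq> 0}"
    by (auto simp: P_def)
  moreover have "\<forall>p\<in>P. polyfun p"
    by (simp add: P_def)
  ultimately show ?thesis
    unfolding zariski_open_in_def by blast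
qed

lemma zariski_dense_open_self: "zariski_dense_open X X"
  unfolding zariski_dense_open_def
  using zariski_open_in_self zariski_open_in_subset by blast

lemma zariski_dense_open_Int:
  assumes "zariski_dense_open X U" and "zariski_dense_open X V"
  shows "zariski_dense_open X (U \<inter> V)"
  using assms zariski_open_in_Int unfolding zariski_dense_open_def
  by (metis Int_assoc)

lemma regular_on_poly: "polyfun p \<Longrightarrow> regular_on U p"
  unfolding regular_on_def
  by (intro ballI exI[of _ p] exI[of _ "\<lambda>x. 1"]) (auto intro: polyfun_const)

lemma regular_on_cong: "(\<And>x. x \<in> U \<Longrightarrow> f x = g x) \<Longrightarrow> regular_on U f \<longleftrightarrow> regular_on U g"
  unfolding regular_on_def by simp

lemma regular_on_subset: "regular_on U f \<Longrightarrow> V \<subseteq> U \<Longrightarrow> regular_on V f"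
  unfolding regular_on_def by blast

lemma regular_on_add:
  assumes "regular_on U f" and "regular_on U g"
  shows "regular_on U (\<lambda>x. f x + g x)"
  unfolding regular_on_def
proof
  fix x assume "x \<in> U"
  then obtain p q p' q' where
    *: "polyfun p" "polyfun q" "q x \<noteq> 0" "\<And>y. y \<in> U \<Longrightarrow> q y \<noteq> 0 \<Longrightarrow> f y = p y / q y"
       "polyfun p'" "polyfun q'" "q' x \<noteq> 0" "\<And>y. y \<in> U \<Longrightarrow> q' y \<noteq> 0 \<Longrightarrow> g y = p' y / q' y"
    using assms unfolding regular_on_def by metis
  then show "\<exists>p q. polyfun p \<and> polyfun q \<and> q x \<noteq> 0 \<and>
      (\<forall>y\<in>U. q y \<noteq> 0 \<longrightarrow> f y + g y = p y / q y)"
    by (intro exI[of _ "\<lambda>y. p y * q' y + p' y * q y"] exI[of _ "\<lambda>y. q y * q' y"])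
      (auto intro!: polyfun_add polyfun_mult simp: field_simps)
qed

lemma regular_on_mult:
  assumes "regular_on U f" and "regular_on U g"
  shows "regular_on U (\<lambda>x. f x * g x)"
  unfolding regular_on_def
proof
  fix x assume "x \<in> U"
  then obtain p q p' q' where
    *: "polyfun p" "polyfun q" "q x \<noteq> 0" "\<And>y. y \<in> U \<Longrightarrow> q y \<noteq> 0 \<Longrightarrow> f y = p y / q y"
       "polyfun p'" "polyfun q'" "q' x \<noteq> 0" "\<And>y. y \<in> U \<Longrightarrow> q' y \<noteq> 0 \<Longrightarrow> g y = p' y / q' y"
    using assms unfolding regular_on_def by metis
  then show "\<exists>p q. polyfun p \<and> polyfun q \<and> q x \<noteq> 0 \<and>
      (\<forall>y\<in>U. q y \<noteq> 0 \<longrightarrow> f y * g y = p y / q y)"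
    by (intro exI[of _ "\<lambda>y. p y * p' y"] exI[of _ "\<lambda>y. q y * q' y"])
      (auto intro!: polyfun_mult)
qed

lemma regular_on_inverse:
  assumes "regular_on U f" and nz: "\<And>x. x \<in> U \<Longrightarrow> f x \<noteq> 0"
  shows "regular_on U (\<lambda>x. inverse (f x))"
  unfolding regular_on_def
proof
  fix x assume x: "x \<in> U"
  then obtain p q where
    *: "polyfun p" "polyfun q" "q x \<noteq> 0" "\<And>y. y \<in> U \<Longrightarrow> q y \<noteq> 0 \<Longrightarrow> f y = p y / q y"
    using assms(1) unfolding regular_on_def by metis
  have "p x \<noteq> 0"
    using *(3,4) x nz by fastforce
  (* The factor q in the denominator restricts the new formula to points where p / q is valid. *)
  with * show "\<exists>p q. polyfun p \<and> polyfun q \<and> q x \<noteq> 0 \<and>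
      (\<forall>y\<in>U. q y \<noteq> 0 \<longrightarrow> inverse (f y) = p y / q y)"
    by (intro exI[of _ "\<lambda>y. q y * q y"] exI[of _ "\<lambda>y. p y * q y"])
      (auto intro!: polyfun_mult)
qed

lemma regular_on_const: "regular_on U (\<lambda>x. c)"
  and regular_on_coord: "regular_on U (\<lambda>x. x $ i)"
  by (auto intro: regular_on_poly polyfun_const polyfun_coord)

lemma regular_on_minus: "regular_on U f \<Longrightarrow> regular_on U (\<lambda>x. - f x)"
  using regular_on_mult[OF regular_on_const[of U "-1"]] by fastforce

lemma regular_on_diff:
  "regular_on U f \<Longrightarrow> regular_on U g \<Longrightarrow> regular_on U (\<lambda>x. f x - g x)"
  using regular_on_add[OF _ regular_on_minus] by fastforce

lemma regular_on_power: "regular_on U f \<Longrightarrow> regular_on U (\<lambda>x. f x ^ n)"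
  by (induction n) (auto intro: regular_on_const regular_on_mult)

lemma regular_on_divide:
  assumes "regular_on U f" and "regular_on U g" and "\<And>x. x \<in> U \<Longrightarrow> g x \<noteq> 0"
  shows "regular_on U (\<lambda>x. f x / g x)"
  unfolding divide_inverse using assms by (intro regular_on_mult regular_on_inverse)

lemmas regular_on_intros =
  regular_on_const regular_on_coord regular_on_add regular_on_mult regular_on_minus
  regular_on_diff regular_on_power regular_on_divide

lemma regular_on_polyfun_comp:
  assumes "polyfun p" and "\<And>i. regular_on U (\<lambda>x. g x $ i)"
  shows "regular_on U (\<lambda>x. p (g x))"
  using assms by (induction rule: polyfun.induct) (auto intro: regular_on_intros)

lemma regular_on_comp:
  assumes f: "regular_on V f" and g: "\<And>i. regular_on U (\<lambda>x. g x $ i)" and "g ` U \<subseteq> V"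
  shows "regular_on U (\<lambda>x. f (g x))"
  unfolding regular_on_def
proof
  fix x assume x: "x \<in> U"
  then obtain p q where pq: "polyfun p" "polyfun q" "q (g x) \<noteq> 0"
    "\<And>y. y \<in> V \<Longrightarrow> q y \<noteq> 0 \<Longrightarrow> f y = p y / q y"
    using f assms(3) unfolding regular_on_def by (metis image_subset_iff)
  obtain p1 q1 where 1: "polyfun p1" "polyfun q1" "q1 x \<noteq> 0"
    "\<And>y. y \<in> U \<Longrightarrow> q1 y \<noteq> 0 \<Longrightarrow> p (g y) = p1 y / q1 y"
    using regular_on_polyfun_comp[OF pq(1) g] x unfolding regular_on_def by metis
  obtain p2 q2 where 2: "polyfun p2" "polyfun q2" "q2 x \<noteq> 0"
    "\<And>y. y \<in> U \<Longrightarrow> q2 y \<noteq> 0 \<Longrightarrow> q (g y) = p2 y / q2 y"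
    using regular_on_polyfun_comp[OF pq(2) g] x unfolding regular_on_def by metis
  let ?n = "\<lambda>y. p1 y * (q2 y * q2 y)" and ?d = "\<lambda>y. q1 y * (p2 y * q2 y)"
  have "p2 x \<noteq> 0"
    using 2 pq(3) x by fastforce
  then have "?d x \<noteq> 0"
    using 1 2 by simp
  moreover have "f (g y) = ?n y / ?d y" if "y \<in> U" "?d y \<noteq> 0" for y
  proof -
    have "q1 y \<noteq> 0" "p2 y \<noteq> 0" "q2 y \<noteq> 0"
      using that by auto
    then show ?thesis
      using pq(4)[of "g y"] 1(4)[of y] 2(4)[of y] that(1) assms(3)
      by (auto simp: image_subset_iff)
  qed
  moreover have "polyfun ?n" "polyfun ?d"
    using 1 2 by (auto intro!: polyfun_mult)
  ultimately show "\<exists>p q. polyfun p \<and> polyfun q \<and> q x \<noteq> 0 \<and>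
      (\<forall>y\<in>U. q y \<noteq> 0 \<longrightarrow> f (g y) = p y / q y)"
    by blast
qed

text \<open>A regular function has no global numerator and denominator. Each local fraction \<open>p / q\<close> contributes
  the open set where \<open>p\<close> and \<open>q\<close> do not vanish, and these sets cover.\<close>

lemma zariski_open_in_regular_nonzero:
  assumes U: "zariski_open_in X U" and f: "regular_on U f"
  shows "zariski_open_in X {x \<in> U. f x \<noteq> 0}"
proof -
  define \<U> where "\<U> = {{x \<in> U. p x * q x \<noteq> 0} |p q. polyfun p \<and> polyfun q \<and>
    (\<forall>y\<in>U. q y \<noteq> 0 \<longrightarrow> f y = p y / q y)}"
  have "zariski_open_in X {x \<in> U. p x * q x \<noteq> 0}" if "polyfun p" "polyfun q" for p q
  proof -
    have "zariski_open_in X {x \<in> X. p x * q x \<noteq> 0}"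
      unfolding zariski_open_in_def
      by (rule exI[of _ "{\<lambda>x. p x * q x}"]) (use that in \<open>auto intro: polyfun_mult\<close>)
    from zariski_open_in_Int[OF U this] show ?thesis
      using zariski_open_in_subset[OF U] by (simp add: Collect_conj_eq Int_absorb2 flip: Int_assoc)
  qed
  then have "zariski_open_in X (\<Union>\<U>)"
    unfolding \<U>_def by (intro zariski_open_in_Union) blast
  moreover have "\<Union>\<U> = {x \<in> U. f x \<noteq> 0}"
  proof
    show "\<Union>\<U> \<subseteq> {x \<in> U. f x \<noteq> 0}"
      unfolding \<U>_def by auto
    show "{x \<in> U. f x \<noteq> 0} \<subseteq> \<Union>\<U>"
    proof
      fix x assume x: "x \<in> {x \<in> U. f x \<noteq> 0}"
      then obtain p q where pq: "polyfun p" "polyfun q" "q x \<noteq> 0"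
        "\<forall>y\<in>U. q y \<noteq> 0 \<longrightarrow> f y = p y / q y"
        using f unfolding regular_on_def by blast
      moreover have "p x \<noteq> 0"
        using pq x by auto
      ultimately show "x \<in> \<Union>\<U>"
        unfolding \<U>_def using x by auto
    qed
  qed
  ultimately show ?thesis by simp
qed

section \<open>Calculus of rational maps\<close>

text \<open>The domain of a composition of partial maps is such a preimage; points without a value are left
  out.\<close>

definition map_preimage :: "('a \<rightharpoonup> 'b) \<Rightarrow> 'b set \<Rightarrow> 'a set" where
  "map_preimage f W = {x. \<exists>y\<in>W. f x = Some y}"

lemma map_preimage_iff: "x \<in> map_preimage f W \<longleftrightarrow> (\<exists>y\<in>W. f x = Some y)"
  by (simp add: map_preimage_def)

lemma dom_map_comp: "dom (f \<circ>\<^sub>m g) = map_preimage g (dom f)"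
  by (auto simp: map_preimage_def map_comp_def split: option.splits)

lemma map_comp_comp_assoc: "f \<circ>\<^sub>m g \<circ>\<^sub>m h = f \<circ>\<^sub>m (g \<circ>\<^sub>m h)"
  by (auto simp: map_comp_def fun_eq_iff split: option.splits)

lemma zariski_open_in_map_preimage:
  assumes f: "rational_map X Y f" and W: "zariski_open_in Y W"
  shows "zariski_open_in X (map_preimage f W)"
proof -
  have dom: "zariski_open_in X (dom f)" and ran: "ran f \<subseteq> Y"
    and reg: "\<And>i. regular_on (dom f) (\<lambda>x. the (f x) $ i)"
    using f by (auto simp: rational_map_def zariski_dense_open_def)
  from W obtain P where P: "\<forall>p\<in>P. polyfun p" "W = {y \<in> Y. \<exists>p\<in>P. p y \<noteq> 0}"
    unfolding zariski_open_in_def by blast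
  have "zariski_open_in X (\<Union>p\<in>P. {x \<in> dom f. p (the (f x)) \<noteq> 0})"
    using P(1) by (intro zariski_open_in_Union)
      (auto intro!: zariski_open_in_regular_nonzero[OF dom] regular_on_polyfun_comp reg)
  moreover have "(\<Union>p\<in>P. {x \<in> dom f. p (the (f x)) \<noteq> 0}) = map_preimage f W"
    using ran unfolding P(2) map_preimage_def ran_def by force
  ultimately show ?thesis by (rule back_subst)
qed

lemma total_on_simps [simp]:
  "dom (total_on U F) = U"
  "ran (total_on U F) = F ` U"
  "x \<in> U \<Longrightarrow> total_on U F x = Some (F x)"
  by (auto simp: total_on_def ran_def split: if_splits)

lemma map_preimage_total_on: "map_preimage (total_on U F) W = {x \<in> U. F x \<in> W}"
  by (auto simp: map_preimage_def total_on_def split: if_splits)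

lemma rational_inverse_sym: "rational_inverse X Y f g \<Longrightarrow> rational_inverse Y X g f"
  unfolding rational_inverse_def by blast

lemma rational_inverse_rat_inv:
  "birational_map X Y f \<Longrightarrow> rational_inverse X Y f (rat_inv X Y f)"
  unfolding birational_map_def rat_inv_def by (metis someI_ex)

lemma rational_map_total_on:
  assumes "zariski_dense_open X U" and "\<And>x. x \<in> U \<Longrightarrow> F x \<in> Y"
    and "\<And>i. regular_on U (\<lambda>x. F x $ i)"
  shows "rational_map X Y (total_on U F)"
  unfolding rational_map_def
  using assms by (auto simp: regular_on_cong[of U "\<lambda>x. the (total_on U F x) $ _" "\<lambda>x. F x $ _"])

lemma rational_map_imp_dense_dom: "rational_map X Y f \<Longrightarrow> zariski_dense_open X (dom f)"
  by (simp add: rational_map_def)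

text \<open>Here the rational inverse \<open>g\<close> supplies dominance. A nonempty open \<open>V \<subseteq> X\<close> pulls back along \<open>g\<close> to
  a nonempty open subset of \<open>Y\<close>, which meets \<open>W\<close>; \<open>g\<close> moves a common point to a point of \<open>V\<close> that \<open>f\<close>
  sends into \<open>W\<close>.\<close>

lemma zariski_dense_open_map_preimage:
  assumes inv: "rational_inverse X Y f g" and W: "zariski_dense_open Y W"
  shows "zariski_dense_open X (map_preimage f W)"
  unfolding zariski_dense_open_def
proof (intro conjI allI impI)
  have f: "rational_map X Y f" and g: "rational_map Y X g"
    using inv by (auto simp: rational_inverse_def)
  show "zariski_open_in X (map_preimage f W)"
    using f W by (auto intro: zariski_open_in_map_preimage simp: zariski_dense_open_def)
  obtain U where U: "zariski_dense_open X U" "U \<subseteq> dom (g \<circ>\<^sub>m f)"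
    "\<And>x. x \<in> U \<Longrightarrow> (g \<circ>\<^sub>m f) x = Some x"
    using inv zariski_open_in_subset
    by (fastforce simp: rational_inverse_def rational_eq_def)
  obtain U' where U': "zariski_dense_open Y U'" "U' \<subseteq> dom (f \<circ>\<^sub>m g)"
    "\<And>y. y \<in> U' \<Longrightarrow> (f \<circ>\<^sub>m g) y = Some y"
    using inv zariski_open_in_subset
    by (fastforce simp: rational_inverse_def rational_eq_def)
  fix V assume "zariski_open_in X V \<and> V \<noteq> {}"
  then have V: "zariski_open_in X V" "V \<noteq> {}" by auto
  then obtain x where x: "x \<in> U" "x \<in> V"
    using U(1) unfolding zariski_dense_open_def by blast
  let ?V' = "map_preimage g V"
  have "zariski_open_in Y ?V'"
    using g V(1) by (rule zariski_open_in_map_preimage)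
  moreover obtain y where "f x = Some y" "g y = Some x"
    using U(3)[OF x(1)] by (auto simp: map_comp_Some_iff)
  with x(2) have "y \<in> ?V'"
    by (auto simp: map_preimage_iff)
  ultimately obtain z where z: "z \<in> W" "z \<in> U'" "z \<in> ?V'"
    using zariski_dense_open_Int[OF W U'(1)] unfolding zariski_dense_open_def by blast
  then obtain v where v: "g z = Some v" "v \<in> V"
    by (auto simp: map_preimage_iff)
  then have "f v = Some z"
    using U'(3)[OF z(2)] by (auto simp: map_comp_Some_iff)
  then have "v \<in> map_preimage f W"
    using z(1) by (auto simp: map_preimage_iff)
  then show "map_preimage f W \<inter> V \<noteq> {}"
    using v(2) by blast
qed

lemma rational_eq_sym: "rational_eq X f g \<Longrightarrow> rational_eq X g f"
  unfolding rational_eq_def by (simp add: Int_commute eq_commute)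

lemma rational_eq_trans [trans]:
  assumes "rational_eq X f g" and "rational_eq X g h"
  shows "rational_eq X f h"
proof -
  from assms obtain U V where
    "zariski_dense_open X U" "U \<subseteq> dom f \<inter> dom g" "\<forall>x\<in>U. f x = g x"
    "zariski_dense_open X V" "V \<subseteq> dom g \<inter> dom h" "\<forall>x\<in>V. g x = h x"
    unfolding rational_eq_def by blast
  then show ?thesis
    unfolding rational_eq_def by (intro exI[of _ "U \<inter> V"]) (auto intro: zariski_dense_open_Int)
qed

text \<open>The equality holds on the preimage of a dense open set. That this preimage is dense is why the
  inner map has to have a rational inverse, here and in the lemmas on composition below.\<close>

lemma rational_eq_comp_right:
  assumes g: "rational_inverse X Y g g'" and eq: "rational_eq Y f f'"
  shows "rational_eq X (f \<circ>\<^sub>m g) (f' \<circ>\<^sub>m g)"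
proof -
  from eq obtain U where U: "zariski_dense_open Y U" "U \<subseteq> dom f \<inter> dom f'" "\<forall>y\<in>U. f y = f' y"
    unfolding rational_eq_def by blast
  show ?thesis
    unfolding rational_eq_def
  proof (intro exI[of _ "map_preimage g U"] conjI)
    show "zariski_dense_open X (map_preimage g U)"
      using g U(1) by (rule zariski_dense_open_map_preimage)
  qed (use U in \<open>auto 4 4 simp: dom_map_comp map_preimage_iff map_comp_def\<close>)
qed

lemma rational_eq_comp_left:
  assumes g: "rational_inverse X Y g g\<^sub>i" and f: "rational_map Y Z f" and eq: "rational_eq X g g'"
  shows "rational_eq X (f \<circ>\<^sub>m g) (f \<circ>\<^sub>m g')"
proof -
  from eq obtain U where U: "zariski_dense_open X U" "U \<subseteq> dom g \<inter> dom g'" "\<forall>y\<in>U. g y = g' y"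
    unfolding rational_eq_def by blast
  show ?thesis
    unfolding rational_eq_def
  proof (intro exI[of _ "U \<inter> map_preimage g (dom f)"] conjI)
    show "zariski_dense_open X (U \<inter> map_preimage g (dom f))"
      using U(1) zariski_dense_open_map_preimage[OF g rational_map_imp_dense_dom[OF f]]
      by (rule zariski_dense_open_Int)
  qed (use U in \<open>auto simp: dom_map_comp map_preimage_iff map_comp_def\<close>)
qed

lemma rational_eq_id_comp: "rational_map X Y f \<Longrightarrow> rational_eq X (total_on Y (\<lambda>y. y) \<circ>\<^sub>m f) f"
  unfolding rational_eq_def
  by (rule exI[of _ "dom f"])
    (auto simp: rational_map_def dom_map_comp map_preimage_iff map_comp_def ran_def total_on_def)

lemma rational_eq_comp_id: "rational_map X Y f \<Longrightarrow> rational_eq X (f \<circ>\<^sub>m total_on X (\<lambda>x. x)) f"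
  unfolding rational_eq_def
  by (rule exI[of _ "dom f"])
    (auto simp: rational_map_def dom_map_comp map_preimage_iff map_comp_def total_on_def
      zariski_dense_open_def dest!: zariski_open_in_subset)

lemma rational_map_comp:
  assumes g: "rational_inverse X Y g g'" and f: "rational_map Y Z f"
  shows "rational_map X Z (f \<circ>\<^sub>m g)"
  unfolding rational_map_def
proof (intro conjI allI)
  let ?D = "map_preimage g (dom f)"
  show "zariski_dense_open X (dom (f \<circ>\<^sub>m g))"
    using zariski_dense_open_map_preimage[OF g rational_map_imp_dense_dom[OF f]]
    by (simp add: dom_map_comp)
  show "ran (f \<circ>\<^sub>m g) \<subseteq> Z"
    using f by (auto simp: rational_map_def ran_def map_comp_Some_iff)
  fix i
  have "regular_on ?D (\<lambda>x. the (f (the (g x))) $ i)"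
  proof (rule regular_on_comp[where f = "\<lambda>y. the (f y) $ i"])
    show "regular_on (dom f) (\<lambda>y. the (f y) $ i)"
      using f by (simp add: rational_map_def)
    show "regular_on ?D (\<lambda>x. the (g x) $ j)" for j
    proof (rule regular_on_subset)
      show "regular_on (dom g) (\<lambda>x. the (g x) $ j)"
        using g by (simp add: rational_inverse_def rational_map_def)
    qed (auto simp: map_preimage_iff)
  qed (auto simp: map_preimage_iff)
  moreover have "the ((f \<circ>\<^sub>m g) x) $ i = the (f (the (g x))) $ i" if "x \<in> ?D" for x
    using that by (auto simp: map_preimage_iff map_comp_def)
  ultimately show "regular_on (dom (f \<circ>\<^sub>m g)) (\<lambda>x. the ((f \<circ>\<^sub>m g) x) $ i)"
    unfolding dom_map_comp by (simp cong: regular_on_cong)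
qed

lemma rational_inverse_comp_eq_id:
  assumes f: "rational_inverse X Y f f'" and g: "rational_inverse Y Z g g'"
  shows "rational_eq X (f' \<circ>\<^sub>m g' \<circ>\<^sub>m (g \<circ>\<^sub>m f)) (total_on X (\<lambda>x. x))"
proof -
  have rat: "rational_map X Y f" "rational_map Y X f'"
    using f by (auto simp: rational_inverse_def)
  have "rational_eq X (g' \<circ>\<^sub>m g \<circ>\<^sub>m f) (total_on Y (\<lambda>y. y) \<circ>\<^sub>m f)"
    using f by (rule rational_eq_comp_right) (use g in \<open>simp add: rational_inverse_def\<close>)
  also have "rational_eq X \<dots> f"
    using rat(1) by (rule rational_eq_id_comp)
  finally have "rational_eq X f (g' \<circ>\<^sub>m g \<circ>\<^sub>m f)"
    by (rule rational_eq_sym)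
  then have "rational_eq X (f' \<circ>\<^sub>m f) (f' \<circ>\<^sub>m (g' \<circ>\<^sub>m g \<circ>\<^sub>m f))"
    by (rule rational_eq_comp_left[OF f rat(2)])
  then have "rational_eq X (f' \<circ>\<^sub>m (g' \<circ>\<^sub>m g \<circ>\<^sub>m f)) (f' \<circ>\<^sub>m f)"
    by (rule rational_eq_sym)
  also have "rational_eq X \<dots> (total_on X (\<lambda>x. x))"
    using f by (simp add: rational_inverse_def)
  finally show ?thesis
    by (simp add: map_comp_comp_assoc)
qed

lemma rational_inverse_comp:
  assumes f: "rational_inverse X Y f f'" and g: "rational_inverse Y Z g g'"
  shows "rational_inverse X Z (g \<circ>\<^sub>m f) (f' \<circ>\<^sub>m g')"
  unfolding rational_inverse_def
proof (intro conjI)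
  show "rational_map X Z (g \<circ>\<^sub>m f)" "rational_map Z X (f' \<circ>\<^sub>m g')"
    using rational_map_comp[OF f, of Z g] rational_map_comp[OF rational_inverse_sym[OF g], of X f']
      f g by (simp_all add: rational_inverse_def)
  show "rational_eq X (f' \<circ>\<^sub>m g' \<circ>\<^sub>m (g \<circ>\<^sub>m f)) (total_on X (\<lambda>x. x))"
    using f g by (rule rational_inverse_comp_eq_id)
  show "rational_eq Z (g \<circ>\<^sub>m f \<circ>\<^sub>m (f' \<circ>\<^sub>m g')) (total_on Z (\<lambda>z. z))"
    using rational_inverse_sym[OF g] rational_inverse_sym[OF f] by (rule rational_inverse_comp_eq_id)
qed

lemma rational_inverse_unique:
  assumes g: "rational_inverse X Y f g" and g': "rational_inverse X Y f g'"
  shows "rational_eq Y g g'"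
proof -
  have rat: "rational_map Y X g" "rational_map Y X g'"
    using g g' by (auto simp: rational_inverse_def)
  have "rational_eq Y (f \<circ>\<^sub>m g') (total_on Y (\<lambda>y. y))"
    using g' by (simp add: rational_inverse_def)
  then have "rational_eq Y (g \<circ>\<^sub>m (f \<circ>\<^sub>m g')) (g \<circ>\<^sub>m total_on Y (\<lambda>y. y))"
    by (rule rational_eq_comp_left[OF rational_inverse_comp[OF rational_inverse_sym[OF g'] g'] rat(1)])
  also have "rational_eq Y \<dots> g"
    using rat(1) by (rule rational_eq_comp_id)
  finally have "rational_eq Y g (g \<circ>\<^sub>m f \<circ>\<^sub>m g')"
    unfolding map_comp_comp_assoc by (rule rational_eq_sym)
  also have "rational_eq Y \<dots> (total_on X (\<lambda>x. x) \<circ>\<^sub>m g')"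
    by (rule rational_eq_comp_right[OF rational_inverse_sym[OF g']])
      (use g in \<open>simp add: rational_inverse_def\<close>)
  also have "rational_eq Y \<dots> g'"
    using rat(2) by (rule rational_eq_id_comp)
  finally show ?thesis .
qed

lemma rational_inverse_cong:
  assumes f: "rational_inverse X Y f g" and f': "rational_map X Y f'" and eq: "rational_eq X f f'"
  shows "rational_inverse X Y f' g"
  unfolding rational_inverse_def
proof (intro conjI)
  have g: "rational_map Y X g"
    using f by (simp add: rational_inverse_def)
  have "rational_eq X (g \<circ>\<^sub>m f') (g \<circ>\<^sub>m f)"
    by (rule rational_eq_sym) (rule rational_eq_comp_left[OF f g eq])
  also have "rational_eq X \<dots> (total_on X (\<lambda>x. x))"
    using f by (simp add: rational_inverse_def)
  finally show "rational_eq X (g \<circ>\<^sub>m f') (total_on X (\<lambda>x. x))" .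
  have "rational_eq Y (f' \<circ>\<^sub>m g) (f \<circ>\<^sub>m g)"
    by (rule rational_eq_comp_right[OF rational_inverse_sym[OF f] rational_eq_sym[OF eq]])
  also have "rational_eq Y \<dots> (total_on Y (\<lambda>y. y))"
    using f by (simp add: rational_inverse_def)
  finally show "rational_eq Y (f' \<circ>\<^sub>m g) (total_on Y (\<lambda>y. y))" .
qed (use f f' in \<open>auto simp: rational_inverse_def\<close>)

lemma rational_inverse_total_on:
  assumes F: "rational_map X Y (total_on U F)" and G: "rational_map Y X (total_on V G)"
    and GF: "\<And>x. x \<in> U \<Longrightarrow> F x \<in> V \<Longrightarrow> G (F x) = x"
    and FG: "\<And>y. y \<in> V \<Longrightarrow> G y \<in> U \<Longrightarrow> F (G y) = y"
    and dX: "zariski_dense_open X {x \<in> U. F x \<in> V}"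
    and dY: "zariski_dense_open Y {y \<in> V. G y \<in> U}"
  shows "rational_inverse X Y (total_on U F) (total_on V G)"
  unfolding rational_inverse_def
proof (intro conjI F G)
  have "U \<subseteq> X" "V \<subseteq> Y"
    using F G by (auto simp: rational_map_def zariski_dense_open_def dest!: zariski_open_in_subset)
  then show "rational_eq X (total_on V G \<circ>\<^sub>m total_on U F) (total_on X (\<lambda>x. x))"
    "rational_eq Y (total_on U F \<circ>\<^sub>m total_on V G) (total_on Y (\<lambda>y. y))"
    unfolding rational_eq_def using dX dY GF FG
    by (intro exI[of _ "{x \<in> U. F x \<in> V}"] exI[of _ "{y \<in> V. G y \<in> U}"];
        auto simp: dom_map_comp map_preimage_total_on subset_iff)+
qed

lemma conjugate_rational_inverse:
  assumes \<phi>: "rational_inverse X Y \<phi> \<psi>" and h: "rational_inverse Y Y h h'"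
  shows "rational_inverse X X (\<psi> \<circ>\<^sub>m h \<circ>\<^sub>m \<phi>) (\<psi> \<circ>\<^sub>m h' \<circ>\<^sub>m \<phi>)"
  using rational_inverse_comp[OF \<phi> rational_inverse_comp[OF h rational_inverse_sym[OF \<phi>]]]
  by (simp add: map_comp_comp_assoc)

lemma conjugate_comp:
  assumes \<phi>: "rational_inverse X Y \<phi> \<psi>" and f: "rational_inverse Y Y f f'"
    and h: "rational_inverse Y Y h h'"
  shows "rational_eq X (\<psi> \<circ>\<^sub>m f \<circ>\<^sub>m \<phi> \<circ>\<^sub>m (\<psi> \<circ>\<^sub>m h \<circ>\<^sub>m \<phi>)) (\<psi> \<circ>\<^sub>m (f \<circ>\<^sub>m h) \<circ>\<^sub>m \<phi>)"
proof -
  note h\<phi> = rational_inverse_comp[OF \<phi> h]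
  have "rational_eq X (\<phi> \<circ>\<^sub>m \<psi> \<circ>\<^sub>m (h \<circ>\<^sub>m \<phi>)) (total_on Y (\<lambda>y. y) \<circ>\<^sub>m (h \<circ>\<^sub>m \<phi>))"
    by (rule rational_eq_comp_right[OF h\<phi>]) (use \<phi> in \<open>simp add: rational_inverse_def\<close>)
  also have "rational_eq X \<dots> (h \<circ>\<^sub>m \<phi>)"
    by (rule rational_eq_id_comp) (use h\<phi> in \<open>simp add: rational_inverse_def\<close>)
  finally have "rational_eq X (h \<circ>\<^sub>m \<phi>) (\<phi> \<circ>\<^sub>m \<psi> \<circ>\<^sub>m (h \<circ>\<^sub>m \<phi>))"
    by (rule rational_eq_sym)
  moreover have "rational_map Y X (\<psi> \<circ>\<^sub>m f)"
    using rational_inverse_comp[OF f rational_inverse_sym[OF \<phi>]]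
    by (simp add: rational_inverse_def)
  ultimately have "rational_eq X (\<psi> \<circ>\<^sub>m f \<circ>\<^sub>m (h \<circ>\<^sub>m \<phi>)) (\<psi> \<circ>\<^sub>m f \<circ>\<^sub>m (\<phi> \<circ>\<^sub>m \<psi> \<circ>\<^sub>m (h \<circ>\<^sub>m \<phi>)))"
    by (intro rational_eq_comp_left[OF h\<phi>])
  then show ?thesis
    unfolding map_comp_comp_assoc by (rule rational_eq_sym)
qed

text \<open>The relation \<open>\<phi> F = h \<phi>\<close> gives \<open>\<psi> h \<phi> = \<psi> \<phi> F\<close>, and one has to cancel \<open>\<psi> \<phi>\<close> at the points \<open>F x\<close>. These
  could all avoid a given dense open set, because \<open>F\<close> is not known to be dominant. The hypothesis that
  \<open>\<psi>\<close> inverts \<open>\<phi>\<close> at every point where \<open>\<psi> \<phi>\<close> is defined removes this difficulty.\<close>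

lemma conjugate_eqI:
  assumes \<phi>: "rational_inverse X Y \<phi> \<psi>" and h: "rational_inverse Y Y h h'"
    and \<psi>: "\<And>x y. \<phi> x = Some y \<Longrightarrow> y \<in> dom \<psi> \<Longrightarrow> \<psi> y = Some x"
    and D: "zariski_dense_open X D" "D \<subseteq> dom F"
    and semi: "\<And>x. x \<in> D \<Longrightarrow> (\<phi> \<circ>\<^sub>m F) x = (h \<circ>\<^sub>m \<phi>) x"
  shows "rational_eq X (\<psi> \<circ>\<^sub>m h \<circ>\<^sub>m \<phi>) F"
  unfolding rational_eq_def
proof (intro exI[of _ "D \<inter> dom (\<psi> \<circ>\<^sub>m h \<circ>\<^sub>m \<phi>)"] conjI ballI)
  have "zariski_dense_open X (dom (\<psi> \<circ>\<^sub>m h \<circ>\<^sub>m \<phi>))"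
    using conjugate_rational_inverse[OF \<phi> h]
    by (simp add: rational_inverse_def rational_map_def)
  with D(1) show "zariski_dense_open X (D \<inter> dom (\<psi> \<circ>\<^sub>m h \<circ>\<^sub>m \<phi>))"
    by (rule zariski_dense_open_Int)
  fix x assume x: "x \<in> D \<inter> dom (\<psi> \<circ>\<^sub>m h \<circ>\<^sub>m \<phi>)"
  then obtain y where "(\<psi> \<circ>\<^sub>m (h \<circ>\<^sub>m \<phi>)) x = Some y"
    unfolding map_comp_comp_assoc by blast
  then obtain z where z: "(h \<circ>\<^sub>m \<phi>) x = Some z" "z \<in> dom \<psi>"
    unfolding map_comp_Some_iff[of \<psi>] by blast
  then have "(\<phi> \<circ>\<^sub>m F) x = Some z"
    using semi[of x] x by simp
  then obtain w where "F x = Some w" "\<phi> w = Some z"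
    unfolding map_comp_Some_iff by blast
  then show "(\<psi> \<circ>\<^sub>m h \<circ>\<^sub>m \<phi>) x = F x"
    using \<psi>[of w z] z unfolding map_comp_comp_assoc map_comp_def[of \<psi> "h \<circ>\<^sub>m \<phi>"] by simp
qed (use D in auto)

section \<open>Dense open subsets of monic hypersurfaces\<close>

lemma complex_quadratic_factor:
  fixes b d :: complex
  obtains r1 r2 where "\<And>w. w\<^sup>2 + b * w + d = (w - r1) * (w - r2)"
proof
  fix w
  let ?s = "csqrt (b\<^sup>2 - 4 * d)"
  have "(w - (- b + ?s) / 2) * (w - (- b - ?s) / 2) = w\<^sup>2 + b * w + (b\<^sup>2 - ?s\<^sup>2) / 4"
    by (simp add: field_simps power2_eq_square)
  then show "w\<^sup>2 + b * w + d = (w - (- b + ?s) / 2) * (w - (- b - ?s) / 2)"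
    by simp
qed

lemma norm_axis: "norm (axis i (a :: 'a::real_inner)) = norm a"
  by (simp add: norm_eq_sqrt_inner inner_axis_axis)

text \<open>Move \<open>x\<close> to \<open>z\<close> by changing the coordinate \<open>k\<close> a little. Then \<open>F z\<close> is small and equals the product of
  the two differences between \<open>z $ l\<close> and the roots of the quadratic in the coordinate \<open>l\<close>, so one of
  the roots is near \<open>z $ l\<close>.\<close>

lemma monic_hypersurface_approx:
  fixes F :: "complex^'n \<Rightarrow> complex"
  assumes cont: "continuous_on UNIV F" and "k \<noteq> l"
    and monic: "\<And>z. \<exists>b d. \<forall>w. F (\<chi> i. if i = l then w else z $ i) = w\<^sup>2 + b * w + d"
    and x: "F x = 0" and "\<epsilon> > 0"
  obtains y where "F y = 0" and "y $ k \<noteq> c" and "dist y x < \<epsilon>"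
proof (cases "x $ k = c")
  case True
  have "isCont F x"
    using cont by (simp add: continuous_on_eq_continuous_at)
  then obtain \<delta> where \<delta>: "\<delta> > 0" "\<And>z. dist z x < \<delta> \<Longrightarrow> dist (F z) (F x) < (\<epsilon> / 2)\<^sup>2"
    using \<open>\<epsilon> > 0\<close> unfolding continuous_at_eps_delta by (metis half_gt_zero zero_less_power)
  define t where "t = min (\<epsilon> / 2) \<delta> / 2"
  have t: "0 < t" "t < \<epsilon> / 2" "t < \<delta>"
    using \<delta>(1) \<open>\<epsilon> > 0\<close> by (auto simp: t_def)
  define z where "z = x + axis k (complex_of_real t)"
  have "dist z x < \<delta>"
    using t by (simp add: z_def dist_norm norm_axis)
  with \<delta>(2) x have Fz: "norm (F z) < (\<epsilon> / 2)\<^sup>2"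
    by fastforce
  obtain b d where "\<And>w. F (\<chi> i. if i = l then w else z $ i) = w\<^sup>2 + b * w + d"
    using monic by blast
  then obtain r1 r2
    where roots: "\<And>w. F (\<chi> i. if i = l then w else z $ i) = (w - r1) * (w - r2)"
    using complex_quadratic_factor[of b d] by metis
  have zl: "z $ l = x $ l"
    using \<open>k \<noteq> l\<close> by (simp add: z_def axis_def)
  moreover have "(\<chi> i. if i = l then z $ l else z $ i) = z"
    by (simp add: vec_eq_iff)
  ultimately have "norm (x $ l - r1) * norm (x $ l - r2) < (\<epsilon> / 2) * (\<epsilon> / 2)"
    using roots[of "z $ l"] Fz by (simp add: norm_mult power2_eq_square)
  then have "norm (x $ l - r1) < \<epsilon> / 2 \<or> norm (x $ l - r2) < \<epsilon> / 2"
    using \<open>\<epsilon> > 0\<close> mult_mono[of "\<epsilon> / 2" "norm (x $ l - r1)" "\<epsilon> / 2" "norm (x $ l - r2)"]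
    by fastforce
  then obtain r where r: "norm (x $ l - r) < \<epsilon> / 2" "r = r1 \<or> r = r2"
    by blast
  define y where "y = (\<chi> i. if i = l then r else z $ i)"
  show thesis
  proof
    show "F y = 0"
      using roots[of r] r(2) by (auto simp: y_def)
    show "y $ k \<noteq> c"
      using True \<open>k \<noteq> l\<close> t(1) by (simp add: y_def z_def axis_def)
    have "y - x = axis k (complex_of_real t) + axis l (r - x $ l)"
      using \<open>k \<noteq> l\<close> by (simp add: vec_eq_iff y_def z_def axis_def)
    then have "dist y x \<le> t + norm (x $ l - r)"
      using norm_triangle_ineq[of "axis k (complex_of_real t)" "axis l (r - x $ l)"] t(1)
      by (simp add: dist_norm norm_axis norm_minus_commute)
    with t(2) r(1) show "dist y x < \<epsilon>" by simp
  qed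
qed (use that[of x] assms in auto)

text \<open>A polynomial that does not vanish at \<open>x\<close> does not vanish at nearby points, so density for the
  Euclidean topology implies density for the Zariski topology.\<close>

lemma zariski_dense_open_monic_hypersurface:
  fixes F :: "complex^'n \<Rightarrow> complex"
  assumes "continuous_on UNIV F" and "k \<noteq> l"
    and "\<And>z. \<exists>b d. \<forall>w. F (\<chi> i. if i = l then w else z $ i) = w\<^sup>2 + b * w + d"
  shows "zariski_dense_open {x. F x = 0} {x \<in> {x. F x = 0}. x $ k \<noteq> c}"
  unfolding zariski_dense_open_def
proof (intro conjI allI impI)
  show "zariski_open_in {x. F x = 0} {x \<in> {x. F x = 0}. x $ k \<noteq> c}"
    using zariski_open_in_regular_nonzero[of "{x. F x = 0}" "{x. F x = 0}" "\<lambda>x. x $ k - c"]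
    by (simp add: zariski_open_in_self regular_on_intros)
  fix V assume V: "zariski_open_in {x. F x = 0} V \<and> V \<noteq> {}"
  then obtain P where P: "\<forall>p\<in>P. polyfun p" "V = {x. F x = 0 \<and> (\<exists>p\<in>P. p x \<noteq> 0)}"
    unfolding zariski_open_in_def by auto
  then obtain x p where x: "F x = 0" "p \<in> P" "p x \<noteq> 0"
    using V by blast
  then have "isCont p x"
    using P(1) polyfun_continuous[of p] by (auto simp: continuous_on_eq_continuous_at)
  then obtain \<epsilon> where \<epsilon>: "\<epsilon> > 0" "\<And>y. dist y x < \<epsilon> \<Longrightarrow> p y \<noteq> 0"
    using x(3) continuous_at_avoid[of x p 0] by (metis dist_commute)
  obtain y where "F y = 0" "y $ k \<noteq> c" "dist y x < \<epsilon>"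
    using monic_hypersurface_approx[OF assms x(1) \<epsilon>(1)] by blast
  then show "{x \<in> {x. F x = 0}. x $ k \<noteq> c} \<inter> V \<noteq> {}"
    using \<epsilon>(2) x(2) P(2) by auto
qed

section \<open>The two cubic surfaces\<close>

lemma vector_4_nth [simp]:
  "(vector [w, x, y, z] :: 'a::zero^4) $ 1 = w"
  "(vector [w, x, y, z] :: 'a::zero^4) $ 2 = x"
  "(vector [w, x, y, z] :: 'a::zero^4) $ 3 = y"
  "(vector [w, x, y, z] :: 'a::zero^4) $ 4 = z"
  unfolding vector_def by simp_all

lemma cubic_V_iff:
  "x \<in> cubic_V e0 e3 e4 \<longleftrightarrow>
     x$1 * x$2 * x$3 + (x$1)^2 + (x$2)^2 - (tr e3 + e0 * tr e4) * x$1 - (tr e4 + e0 * tr e3) * x$2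
       - e0 * x$3 + (e0^2 + e0 * tr e3 * tr e4 + 1) = 0"
  by (simp add: cubic_V_def theta_def Let_def)

lemma cubic_VI_iff:
  "x \<in> cubic_VI e0 e3 e4 \<kappa> \<longleftrightarrow>
     x$1 * x$2 * x$3 + (x$1)^2 + (x$2)^2 + (x$3)^2 - Theta e0 e3 e4 \<kappa> $ 1 * x$1
       - Theta e0 e3 e4 \<kappa> $ 2 * x$2 - Theta e0 e3 e4 \<kappa> $ 3 * x$3 + Theta4 e0 e3 e4 \<kappa> = 0"
  by (simp add: cubic_VI_def Let_def)

lemma zariski_dense_open_cubic_V:
  assumes "k \<noteq> 1"
  shows "zariski_dense_open (cubic_V e0 e3 e4) {x \<in> cubic_V e0 e3 e4. x $ k \<noteq> c}"
proof -
  let ?F = "\<lambda>x::complex^3. x$1 * x$2 * x$3 + (x$1)^2 + (x$2)^2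
    - (tr e3 + e0 * tr e4) * x$1 - (tr e4 + e0 * tr e3) * x$2
    - e0 * x$3 + (e0^2 + e0 * tr e3 * tr e4 + 1)"
  have "zariski_dense_open {x. ?F x = 0} {x \<in> {x. ?F x = 0}. x $ k \<noteq> c}"
  proof (rule zariski_dense_open_monic_hypersurface)
    fix z :: "complex^3"
    show "\<exists>b d. \<forall>w. ?F (\<chi> i. if i = 1 then w else z $ i) = w\<^sup>2 + b * w + d"
      by (rule exI[of _ "z$2 * z$3 - (tr e3 + e0 * tr e4)"],
          rule exI[of _ "?F (\<chi> i. if i = 1 then 0 else z $ i)"])
        (simp add: algebra_simps)
  qed (use assms in \<open>auto intro!: continuous_intros\<close>)
  also have "{x. ?F x = 0} = cubic_V e0 e3 e4"
    by (auto simp: cubic_V_iff)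
  finally show ?thesis .
qed

lemma zariski_dense_open_cubic_VI:
  assumes "k \<noteq> 1"
  shows "zariski_dense_open (cubic_VI e0 e3 e4 \<kappa>) {x \<in> cubic_VI e0 e3 e4 \<kappa>. x $ k \<noteq> c}"
proof -
  let ?\<Theta> = "Theta e0 e3 e4 \<kappa>"
  let ?F = "\<lambda>x::complex^3. x$1 * x$2 * x$3 + (x$1)^2 + (x$2)^2 + (x$3)^2
    - ?\<Theta> $ 1 * x$1 - ?\<Theta> $ 2 * x$2 - ?\<Theta> $ 3 * x$3 + Theta4 e0 e3 e4 \<kappa>"
  have "zariski_dense_open {x. ?F x = 0} {x \<in> {x. ?F x = 0}. x $ k \<noteq> c}"
  proof (rule zariski_dense_open_monic_hypersurface)
    fix z :: "complex^3"
    show "\<exists>b d. \<forall>w. ?F (\<chi> i. if i = 1 then w else z $ i) = w\<^sup>2 + b * w + d"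
      by (rule exI[of _ "z$2 * z$3 - ?\<Theta> $ 1"],
          rule exI[of _ "?F (\<chi> i. if i = 1 then 0 else z $ i)"])
        (simp add: algebra_simps)
  qed (use assms in \<open>auto intro!: continuous_intros\<close>)
  also have "{x. ?F x = 0} = cubic_VI e0 e3 e4 \<kappa>"
    by (auto simp: cubic_VI_iff)
  finally show ?thesis .
qed

section \<open>Vieta involutions and braid maps\<close>

definition vieta ::
  "complex \<Rightarrow> complex \<Rightarrow> complex \<Rightarrow> complex \<Rightarrow> 3 \<Rightarrow> 3 \<Rightarrow> 3 \<Rightarrow> complex^3 \<Rightarrow> complex^3" where
  "vieta e0 e3 e4 \<kappa> i j k x =
     (\<chi> l. if l = i then Theta e0 e3 e4 \<kappa> $ i - x$i - x$j * x$k else x$l)"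

lemma vieta_cubic_VI:
  assumes "(i, j, k) \<in> {(1, 2, 3), (2, 3, 1), (3, 1, 2)}" and "x \<in> cubic_VI e0 e3 e4 \<kappa>"
  shows "vieta e0 e3 e4 \<kappa> i j k x \<in> cubic_VI e0 e3 e4 \<kappa>"
  using assms by (auto simp: cubic_VI_iff vieta_def algebra_simps power2_eq_square)

lemma vieta_vieta: "i \<noteq> j \<Longrightarrow> i \<noteq> k \<Longrightarrow> vieta e0 e3 e4 \<kappa> i j k (vieta e0 e3 e4 \<kappa> i j k x) = x"
  by (simp add: vieta_def vec_eq_iff)

lemma h_map_eq_vieta:
  "i \<noteq> j \<Longrightarrow> i \<noteq> k \<Longrightarrow> j \<noteq> k \<Longrightarrow>
    h_map e0 e3 e4 \<kappa> i j k x = vieta e0 e3 e4 \<kappa> i j k (vieta e0 e3 e4 \<kappa> j k i x)"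
  by (simp add: h_map_def vieta_def vec_eq_iff Let_def algebra_simps power2_eq_square)

section \<open>The map between the two surfaces\<close>

text \<open>The left-hand side is the equation of \<open>cubic_VI\<close> at the image point \<open>(y1, y2, x3)\<close>, and the last factor
  on the right is the equation of \<open>cubic_V\<close>. The other factors form, up to sign, the determinant of the linear
  part of \<open>(x1, x2) \<mapsto> (y1, y2)\<close>.\<close>

lemma Phi_cubic_identity:
  fixes e \<kappa> a3 a4 x1 x2 x3 :: complex
  assumes "e \<noteq> 0" "\<kappa> \<noteq> 0"
  defines "b1 \<equiv> \<kappa> + inverse \<kappa>" and "b2 \<equiv> e * inverse \<kappa> + inverse e * \<kappa>"
    and "y1 \<equiv> inverse e * \<kappa> * x1 + inverse \<kappa> * x2"
    and "y2 \<equiv> - (inverse e * \<kappa> * x1 * x3) + inverse \<kappa> * x1 - inverse e * \<kappa> * x2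
        + a3 * \<kappa> + a4 * inverse e * \<kappa>"
  shows "y1 * y2 * x3 + y1^2 + y2^2 + x3^2 - (b1*a4+b2*a3) * y1 - (b2*a4+a3*b1) * y2 - (a3*a4+b1*b2) * x3
     + (b1*b2*a3*a4 + (b1^2+b2^2+a3^2+a4^2) - 4) =
   - inverse e * (x3 - (\<kappa>^2 * inverse e + e * (inverse \<kappa>)^2)) *
     (x1*x2*x3 + x1^2 + x2^2 - (a3+e*a4) * x1 - (a4+e*a3)*x2 - e*x3 + (e^2+e*a3*a4+1))"
  unfolding b1_def b2_def y1_def y2_def using assms(1,2)
  by (simp add: field_simps power2_eq_square power3_eq_cube power4_eq_xxxx)

lemma Theta_nth:
  "Theta e0 e3 e4 \<kappa> $ 1 = (\<kappa> + inverse \<kappa>) * tr e4 + (e0 * inverse \<kappa> + inverse e0 * \<kappa>) * tr e3"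
  "Theta e0 e3 e4 \<kappa> $ 2 = (e0 * inverse \<kappa> + inverse e0 * \<kappa>) * tr e4 + tr e3 * (\<kappa> + inverse \<kappa>)"
  "Theta e0 e3 e4 \<kappa> $ 3 = tr e3 * tr e4 + (\<kappa> + inverse \<kappa>) * (e0 * inverse \<kappa> + inverse e0 * \<kappa>)"
  by (simp_all add: Theta_def b_VI_def Let_def)

lemma Theta4_eq:
  "Theta4 e0 e3 e4 \<kappa> =
     (\<kappa> + inverse \<kappa>) * (e0 * inverse \<kappa> + inverse e0 * \<kappa>) * tr e3 * tr e4 +
     ((\<kappa> + inverse \<kappa>)^2 + (e0 * inverse \<kappa> + inverse e0 * \<kappa>)^2 + (tr e3)^2 + (tr e4)^2) - 4"
  by (simp add: Theta4_def b_VI_def Let_def sum_4)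

text \<open>For \<open>e0 \<noteq> 0\<close> and \<open>\<kappa> \<noteq> 0\<close> this is the value of \<open>x\<^sub>3\<close> at which that determinant vanishes.\<close>

definition degenerate_x3 :: "complex \<Rightarrow> complex \<Rightarrow> complex" where
  "degenerate_x3 e0 \<kappa> = \<kappa>^2 * inverse e0 + e0 * (inverse \<kappa>)^2"

lemma Phi_map_cubic_VI_iff:
  assumes "e0 \<noteq> 0" and "\<kappa> \<noteq> 0"
  shows "Phi_map e0 e3 e4 \<kappa> x \<in> cubic_VI e0 e3 e4 \<kappa> \<longleftrightarrow> x $ 3 = degenerate_x3 e0 \<kappa> \<or> x \<in> cubic_V e0 e3 e4"
  unfolding cubic_VI_iff cubic_V_iff degenerate_x3_def Theta_nth Theta4_eq Phi_map_def
  using Phi_cubic_identity[OF assms, of "x$1" "x$2" "x$3" "tr e3" "tr e4"] assms(1)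
  by (simp add: mult.assoc)

text \<open>The solution of the affine system \<open>Phi_map x = y\<close>: Cramer's rule gives \<open>x\<^sub>1\<close>, and the first equation
  then gives \<open>x\<^sub>2\<close>.\<close>

definition Psi_map :: "complex \<Rightarrow> complex \<Rightarrow> complex \<Rightarrow> complex \<Rightarrow> complex^3 \<Rightarrow> complex^3" where
  "Psi_map e0 e3 e4 \<kappa> y =
     (let x1 = (tr e3 * e0 + tr e4 - \<kappa> * y$1 - e0 * inverse \<kappa> * y$2) / (y$3 - degenerate_x3 e0 \<kappa>)
      in vector [x1, \<kappa> * y$1 - inverse e0 * \<kappa>^2 * x1, y$3])"

lemma Psi_Phi_map:
  assumes "e0 \<noteq> 0" and "\<kappa> \<noteq> 0" and "x $ 3 \<noteq> degenerate_x3 e0 \<kappa>"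
  shows "Psi_map e0 e3 e4 \<kappa> (Phi_map e0 e3 e4 \<kappa> x) = x"
proof -
  have "tr e3 * e0 + tr e4 - \<kappa> * Phi_map e0 e3 e4 \<kappa> x $ 1
      - e0 * inverse \<kappa> * Phi_map e0 e3 e4 \<kappa> x $ 2 = x $ 1 * (x $ 3 - degenerate_x3 e0 \<kappa>)"
    using assms(1,2) by (simp add: Phi_map_def degenerate_x3_def field_simps power2_eq_square)
  then have "(tr e3 * e0 + tr e4 - \<kappa> * Phi_map e0 e3 e4 \<kappa> x $ 1
      - e0 * inverse \<kappa> * Phi_map e0 e3 e4 \<kappa> x $ 2) / (Phi_map e0 e3 e4 \<kappa> x $ 3 - degenerate_x3 e0 \<kappa>) = x $ 1"
    using assms(3) by (simp add: Phi_map_def)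
  then show ?thesis
    unfolding Psi_map_def Let_def using assms(1,2)
    by (simp add: vec_eq_iff forall_3) (simp add: Phi_map_def field_simps power2_eq_square)
qed

lemma Phi_Psi_map:
  assumes "e0 \<noteq> 0" and "\<kappa> \<noteq> 0" and "y $ 3 \<noteq> degenerate_x3 e0 \<kappa>"
  shows "Phi_map e0 e3 e4 \<kappa> (Psi_map e0 e3 e4 \<kappa> y) = y"
proof -
  define x1 where "x1 = Psi_map e0 e3 e4 \<kappa> y $ 1"
  have x1: "x1 * (y $ 3 - degenerate_x3 e0 \<kappa>) = tr e3 * e0 + tr e4 - \<kappa> * y$1 - e0 * inverse \<kappa> * y$2"
    using assms(3) by (simp add: x1_def Psi_map_def Let_def)
  have Psi: "Psi_map e0 e3 e4 \<kappa> y = vector [x1, \<kappa> * y$1 - inverse e0 * \<kappa>^2 * x1, y$3]"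
    by (simp add: x1_def Psi_map_def Let_def)
  have "- (inverse e0 * \<kappa> * x1 * y$3) + inverse \<kappa> * x1
      - inverse e0 * \<kappa> * (\<kappa> * y$1 - inverse e0 * \<kappa>^2 * x1) + tr e3 * \<kappa> + tr e4 * inverse e0 * \<kappa>
    = inverse e0 * \<kappa> * (tr e3 * e0 + tr e4 - \<kappa> * y$1 - x1 * (y $ 3 - degenerate_x3 e0 \<kappa>))"
    using assms(1,2) by (simp add: degenerate_x3_def field_simps power2_eq_square)
  also have "\<dots> = y $ 2"
    unfolding x1 using assms(1,2) by (simp add: field_simps)
  finally show ?thesis
    unfolding Psi Phi_map_def using assms(1,2)
    by (simp add: vec_eq_iff forall_3 field_simps power2_eq_square)
qed

section \<open>Explicit forms of the conjugated maps\<close>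

text \<open>The equation of \<open>cubic_V\<close> is monic quadratic in \<open>x\<^sub>1\<close> and in \<open>x\<^sub>2\<close>. This is the Vieta involution in
  \<open>x\<^sub>1\<close> followed by the one in \<open>x\<^sub>2\<close>. On \<open>cubic_VI\<close> the map with indices \<open>(1, 2, 3)\<close> uses the opposite
  order.\<close>

definition vieta_V_map :: "complex \<Rightarrow> complex \<Rightarrow> complex \<Rightarrow> complex^3 \<Rightarrow> complex^3" where
  "vieta_V_map e0 e3 e4 x =
     (let y1 = tr e3 + e0 * tr e4 - x$1 - x$2 * x$3
      in vector [y1, tr e4 + e0 * tr e3 - x$2 - y1 * x$3, x$3])"

lemma vieta_V_map_cubic_V: "x \<in> cubic_V e0 e3 e4 \<Longrightarrow> vieta_V_map e0 e3 e4 x \<in> cubic_V e0 e3 e4"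
  unfolding cubic_V_iff vieta_V_map_def Let_def vector_3 by algebra

lemma Phi_vieta_V_map:
  assumes "e0 \<noteq> 0" and "\<kappa> \<noteq> 0"
  shows "Phi_map e0 e3 e4 \<kappa> (vieta_V_map e0 e3 e4 x) = h_map e0 e3 e4 \<kappa> 1 2 3 (Phi_map e0 e3 e4 \<kappa> x)"
  using assms unfolding h_map_def Let_def Theta_nth Phi_map_def vieta_V_map_def
  by (simp add: vec_eq_iff forall_3) (simp add: field_simps power2_eq_square)

text \<open>Where \<open>x\<^sub>2 \<noteq> 0\<close>, not only the surface but the cubic polynomial itself is invariant under \<open>X_map\<close>, and
  this is an identity of rational functions on affine space.\<close>

lemma X_map_cubic_V:
  assumes "e0 \<noteq> 0" and "\<kappa> \<noteq> 0" and "x \<in> cubic_V e0 e3 e4" and "x $ 2 \<noteq> 0"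
  shows "X_map e0 e3 e4 \<kappa> x \<in> cubic_V e0 e3 e4"
proof -
  have "X_map e0 e3 e4 \<kappa> x $ 1 * X_map e0 e3 e4 \<kappa> x $ 2 * X_map e0 e3 e4 \<kappa> x $ 3
     + (X_map e0 e3 e4 \<kappa> x $ 1)^2 + (X_map e0 e3 e4 \<kappa> x $ 2)^2
     - (tr e3 + e0 * tr e4) * X_map e0 e3 e4 \<kappa> x $ 1 - (tr e4 + e0 * tr e3) * X_map e0 e3 e4 \<kappa> x $ 2
       - e0 * X_map e0 e3 e4 \<kappa> x $ 3 + (e0^2 + e0 * tr e3 * tr e4 + 1) =
    x$1 * x$2 * x$3 + (x$1)^2 + (x$2)^2 - (tr e3 + e0 * tr e4) * x$1 - (tr e4 + e0 * tr e3) * x$2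
       - e0 * x$3 + (e0^2 + e0 * tr e3 * tr e4 + 1)"
    using assms(1,2,4) unfolding X_map_def Let_def theta_def vector_3 vector_4_nth
    by (simp add: field_simps power2_eq_square)
  with assms(3) show ?thesis
    by (simp add: cubic_V_iff)
qed

text \<open>Only the third coordinates differ as rational functions, namely by a multiple of the equation of
  \<open>cubic_V\<close>. The formula for the third coordinate of \<open>X_map\<close> is reduced modulo that equation.\<close>

lemma Phi_X_map:
  assumes "e0 \<noteq> 0" and "\<kappa> \<noteq> 0" and "x \<in> cubic_V e0 e3 e4" and "x $ 2 \<noteq> 0"
  shows "Phi_map e0 e3 e4 \<kappa> (X_map e0 e3 e4 \<kappa> x) =
    vieta e0 e3 e4 \<kappa> 3 1 2 (vieta e0 e3 e4 \<kappa> 2 3 1 (Phi_map e0 e3 e4 \<kappa> x))"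
proof -
  let ?L = "Phi_map e0 e3 e4 \<kappa> (X_map e0 e3 e4 \<kappa> x)"
  let ?R = "vieta e0 e3 e4 \<kappa> 3 1 2 (vieta e0 e3 e4 \<kappa> 2 3 1 (Phi_map e0 e3 e4 \<kappa> x))"
  have "?L $ 1 = ?R $ 1" "?L $ 2 = ?R $ 2"
    using assms(1,2,4) unfolding vieta_def Let_def Theta_nth Phi_map_def X_map_def theta_def
    by (simp_all add: field_simps power2_eq_square)
  moreover have "?L $ 3 = ?R $ 3 - inverse e0 * (x$1 * x$2 * x$3 + (x$1)^2 + (x$2)^2
      - (tr e3 + e0 * tr e4) * x$1 - (tr e4 + e0 * tr e3) * x$2
      - e0 * x$3 + (e0^2 + e0 * tr e3 * tr e4 + 1))"
    using assms(1,2,4) unfolding vieta_def Let_def Theta_nth Phi_map_def X_map_def theta_def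
    by (simp add: field_simps power2_eq_square)
  ultimately show ?thesis
    using assms(3) by (simp add: cubic_V_iff vec_eq_iff forall_3)
qed

section \<open>Rational inverses and conjugation by \<open>Phi\<close>\<close>

lemma total_on_comp:
  "(\<And>x. x \<in> U \<Longrightarrow> F x \<in> V) \<Longrightarrow>
    total_on V G \<circ>\<^sub>m total_on U F = total_on U (\<lambda>x. G (F x))"
  by (auto simp: fun_eq_iff total_on_def map_comp_def)

lemma regular_on_Phi_map: "regular_on U (\<lambda>x. Phi_map e0 e3 e4 \<kappa> x $ i)"
  using exhaust_3[of i] by (auto simp: Phi_map_def intro!: regular_on_intros)

lemma regular_on_Psi_map:
  "(\<And>y. y \<in> U \<Longrightarrow> y $ 3 \<noteq> degenerate_x3 e0 \<kappa>) \<Longrightarrow> regular_on U (\<lambda>y. Psi_map e0 e3 e4 \<kappa> y $ i)"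
  using exhaust_3[of i] by (auto simp: Psi_map_def Let_def intro!: regular_on_intros)

lemma regular_on_X_map:
  "(\<And>x. x \<in> U \<Longrightarrow> x $ 2 \<noteq> 0) \<Longrightarrow> regular_on U (\<lambda>x. X_map e0 e3 e4 \<kappa> x $ i)"
  using exhaust_3[of i] by (auto simp: X_map_def Let_def intro!: regular_on_intros)

lemma regular_on_vieta: "regular_on U (\<lambda>x. vieta e0 e3 e4 \<kappa> i j k x $ l)"
  by (cases "l = i") (auto simp: vieta_def intro!: regular_on_intros)

lemma Phi_rational_inverse:
  assumes "e0 \<noteq> 0" and "\<kappa> \<noteq> 0"
  shows "rational_inverse (cubic_V e0 e3 e4) (cubic_VI e0 e3 e4 \<kappa>) (Phi e0 e3 e4 \<kappa>)
    (total_on {y \<in> cubic_VI e0 e3 e4 \<kappa>. y $ 3 \<noteq> degenerate_x3 e0 \<kappa>} (Psi_map e0 e3 e4 \<kappa>))"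
  unfolding Phi_def
proof (rule rational_inverse_total_on)
  let ?X = "cubic_V e0 e3 e4" and ?Y = "cubic_VI e0 e3 e4 \<kappa>"
  let ?V = "{y \<in> ?Y. y $ 3 \<noteq> degenerate_x3 e0 \<kappa>}"
  have Phi: "Phi_map e0 e3 e4 \<kappa> x \<in> ?Y" if "x \<in> ?X" for x
    using that Phi_map_cubic_VI_iff[OF assms] by blast
  have nth3: "Phi_map e0 e3 e4 \<kappa> x $ 3 = x $ 3" "Psi_map e0 e3 e4 \<kappa> x $ 3 = x $ 3" for x
    by (simp_all add: Phi_map_def Psi_map_def Let_def)
  have Psi: "Psi_map e0 e3 e4 \<kappa> y \<in> ?X" if "y \<in> ?V" for y
    using that Phi_map_cubic_VI_iff[OF assms, of e3 e4 "Psi_map e0 e3 e4 \<kappa> y"]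
      Phi_Psi_map[OF assms, of y] nth3 by simp
  show "rational_map ?X ?Y (total_on ?X (Phi_map e0 e3 e4 \<kappa>))"
    using Phi by (intro rational_map_total_on zariski_dense_open_self regular_on_Phi_map)
  show "rational_map ?Y ?X (total_on ?V (Psi_map e0 e3 e4 \<kappa>))"
    using Psi by (intro rational_map_total_on zariski_dense_open_cubic_VI regular_on_Psi_map) auto
  show "Psi_map e0 e3 e4 \<kappa> (Phi_map e0 e3 e4 \<kappa> x) = x"
    if "x \<in> ?X" "Phi_map e0 e3 e4 \<kappa> x \<in> ?V" for x
    using that nth3 by (intro Psi_Phi_map[OF assms]) simp
  show "Phi_map e0 e3 e4 \<kappa> (Psi_map e0 e3 e4 \<kappa> y) = y" if "y \<in> ?V" for y
    using that by (intro Phi_Psi_map[OF assms]) simp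
  have "{x \<in> ?X. Phi_map e0 e3 e4 \<kappa> x \<in> ?V} = {x \<in> ?X. x $ 3 \<noteq> degenerate_x3 e0 \<kappa>}"
    using Phi nth3 by auto
  then show "zariski_dense_open ?X {x \<in> ?X. Phi_map e0 e3 e4 \<kappa> x \<in> ?V}"
    by (simp add: zariski_dense_open_cubic_V)
  have "{y \<in> ?V. Psi_map e0 e3 e4 \<kappa> y \<in> ?X} = ?V"
    using Psi by auto
  then show "zariski_dense_open ?Y {y \<in> ?V. Psi_map e0 e3 e4 \<kappa> y \<in> ?X}"
    using zariski_dense_open_cubic_VI[of 3 e0 e3 e4 \<kappa>] by simp
qed

lemma vieta_rational_inverse:
  fixes e0 e3 e4 \<kappa> :: complex
  assumes "(i, j, k) \<in> {(1, 2, 3), (2, 3, 1), (3, 1, 2)}"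
  defines "Y \<equiv> cubic_VI e0 e3 e4 \<kappa>"
  shows "rational_inverse Y Y (total_on Y (vieta e0 e3 e4 \<kappa> i j k))
    (total_on Y (vieta e0 e3 e4 \<kappa> i j k))"
proof -
  have Y: "vieta e0 e3 e4 \<kappa> i j k y \<in> Y" if "y \<in> Y" for y
    using vieta_cubic_VI[OF assms(1)] that by (simp add: Y_def)
  then have rat: "rational_map Y Y (total_on Y (vieta e0 e3 e4 \<kappa> i j k))"
    by (intro rational_map_total_on zariski_dense_open_self regular_on_vieta)
  show ?thesis
  proof (rule rational_inverse_total_on[OF rat rat])
    have "{y \<in> Y. vieta e0 e3 e4 \<kappa> i j k y \<in> Y} = Y"
      using Y by blast
    then show "zariski_dense_open Y {y \<in> Y. vieta e0 e3 e4 \<kappa> i j k y \<in> Y}"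
      "zariski_dense_open Y {y \<in> Y. vieta e0 e3 e4 \<kappa> i j k y \<in> Y}"
      by (simp_all add: zariski_dense_open_self)
  qed (use assms in \<open>auto intro!: vieta_vieta\<close>)
qed

lemma h_VI_eq_vieta_comp:
  assumes "(i, j, k) \<in> {(1, 2, 3), (2, 3, 1), (3, 1, 2)}"
  shows "h_VI e0 e3 e4 \<kappa> i j k = total_on (cubic_VI e0 e3 e4 \<kappa>) (vieta e0 e3 e4 \<kappa> i j k) \<circ>\<^sub>m
    total_on (cubic_VI e0 e3 e4 \<kappa>) (vieta e0 e3 e4 \<kappa> j k i)"
proof -
  have "vieta e0 e3 e4 \<kappa> j k i x \<in> cubic_VI e0 e3 e4 \<kappa>" if "x \<in> cubic_VI e0 e3 e4 \<kappa>" for x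
    using assms by (intro vieta_cubic_VI that) auto
  moreover have "\<And>x. h_map e0 e3 e4 \<kappa> i j k x = vieta e0 e3 e4 \<kappa> i j k (vieta e0 e3 e4 \<kappa> j k i x)"
    using assms by (intro h_map_eq_vieta) auto
  then have "h_map e0 e3 e4 \<kappa> i j k = (\<lambda>x. vieta e0 e3 e4 \<kappa> i j k (vieta e0 e3 e4 \<kappa> j k i x))"
    by (rule ext)
  ultimately show ?thesis
    by (simp add: h_VI_def total_on_comp)
qed

lemma h_VI_rational_inverse:
  fixes e0 e3 e4 \<kappa> :: complex
  assumes "(i, j, k) \<in> {(1, 2, 3), (2, 3, 1), (3, 1, 2)}"
  defines "Y \<equiv> cubic_VI e0 e3 e4 \<kappa>"
  shows "rational_inverse Y Y (h_VI e0 e3 e4 \<kappa> i j k)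
    (total_on Y (vieta e0 e3 e4 \<kappa> j k i) \<circ>\<^sub>m total_on Y (vieta e0 e3 e4 \<kappa> i j k))"
proof -
  have "(j, k, i) \<in> {(1, 2, 3), (2, 3, 1), (3, 1, 2)}"
    using assms(1) by auto
  then show ?thesis
    unfolding h_VI_eq_vieta_comp[OF assms(1)] Y_def
    by (rule rational_inverse_comp[OF vieta_rational_inverse vieta_rational_inverse[OF assms(1)]])
qed

text \<open>The braid relation: the two copies of the involution in the coordinate 2 cancel, and what remains is
  the inverse of the map with indices \<open>(3, 1, 2)\<close>.\<close>

lemma h_VI_comp_h_VI:
  fixes e0 e3 e4 \<kappa> :: complex
  defines "Y \<equiv> cubic_VI e0 e3 e4 \<kappa>"
  shows "h_VI e0 e3 e4 \<kappa> 1 2 3 \<circ>\<^sub>m h_VI e0 e3 e4 \<kappa> 2 3 1 =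
    total_on Y (vieta e0 e3 e4 \<kappa> 1 2 3) \<circ>\<^sub>m total_on Y (vieta e0 e3 e4 \<kappa> 3 1 2)"
proof -
  have inv: "h_map e0 e3 e4 \<kappa> 1 2 3 (h_map e0 e3 e4 \<kappa> 2 3 1 y) =
      vieta e0 e3 e4 \<kappa> 1 2 3 (vieta e0 e3 e4 \<kappa> 3 1 2 y)" for y
    by (simp add: h_map_eq_vieta vieta_vieta)
  have "h_map e0 e3 e4 \<kappa> 2 3 1 y \<in> Y" if "y \<in> Y" for y
    using that by (simp add: Y_def h_map_eq_vieta vieta_cubic_VI)
  moreover have "vieta e0 e3 e4 \<kappa> 3 1 2 y \<in> Y" if "y \<in> Y" for y
    using that by (simp add: Y_def vieta_cubic_VI)
  ultimately show ?thesis
    by (simp add: h_VI_def total_on_comp inv flip: Y_def)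
qed

text \<open>The inverse \<open>\<psi>\<close> is arbitrary, but up to \<open>rational_eq\<close> it is the explicit one, for which
  \<open>conjugate_eqI\<close> applies: if \<open>Phi x\<close> lies in its domain, then \<open>x\<^sub>3\<close> is not the degenerate value.\<close>

lemma conjugate_Phi_eqI:
  assumes nz: "e0 \<noteq> 0" "\<kappa> \<noteq> 0"
    and h: "rational_inverse (cubic_VI e0 e3 e4 \<kappa>) (cubic_VI e0 e3 e4 \<kappa>) (total_on (cubic_VI e0 e3 e4 \<kappa>) H) h'"
    and D: "zariski_dense_open (cubic_V e0 e3 e4) D"
    and F: "\<And>x. x \<in> D \<Longrightarrow> F x \<in> cubic_V e0 e3 e4"
    and semi: "\<And>x. x \<in> D \<Longrightarrow> Phi_map e0 e3 e4 \<kappa> (F x) = H (Phi_map e0 e3 e4 \<kappa> x)"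
    and \<psi>: "rational_inverse (cubic_V e0 e3 e4) (cubic_VI e0 e3 e4 \<kappa>) (Phi e0 e3 e4 \<kappa>) \<psi>"
  shows "rational_eq (cubic_V e0 e3 e4)
    (\<psi> \<circ>\<^sub>m total_on (cubic_VI e0 e3 e4 \<kappa>) H \<circ>\<^sub>m Phi e0 e3 e4 \<kappa>) (total_on D F)"
proof -
  let ?X = "cubic_V e0 e3 e4" and ?Y = "cubic_VI e0 e3 e4 \<kappa>"
  let ?V = "{y \<in> ?Y. y $ 3 \<noteq> degenerate_x3 e0 \<kappa>}"
  let ?\<psi>0 = "total_on ?V (Psi_map e0 e3 e4 \<kappa>)"
  note inv = Phi_rational_inverse[OF nz, of e3 e4]
  note h\<phi> = rational_inverse_comp[OF \<psi> h]
  have D_sub: "D \<subseteq> ?X"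
    using D by (simp add: zariski_dense_open_def zariski_open_in_subset)
  have Phi: "Phi_map e0 e3 e4 \<kappa> x \<in> ?Y" if "x \<in> ?X" for x
    using that Phi_map_cubic_VI_iff[OF nz] by blast
  have "rational_eq ?X (\<psi> \<circ>\<^sub>m (total_on ?Y H \<circ>\<^sub>m Phi e0 e3 e4 \<kappa>))
      (?\<psi>0 \<circ>\<^sub>m (total_on ?Y H \<circ>\<^sub>m Phi e0 e3 e4 \<kappa>))"
    by (rule rational_eq_comp_right[OF h\<phi> rational_inverse_unique[OF \<psi> inv]])
  also have "rational_eq ?X \<dots> (total_on D F)"
    unfolding map_comp_comp_assoc[symmetric]
  proof (rule conjugate_eqI[OF inv h _ D])
    show "?\<psi>0 y = Some x" if "Phi e0 e3 e4 \<kappa> x = Some y" "y \<in> dom ?\<psi>0" for x y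
    proof -
      have y: "y = Phi_map e0 e3 e4 \<kappa> x" "y \<in> ?V"
        using that by (auto simp: Phi_def total_on_def split: if_splits)
      then have "x $ 3 \<noteq> degenerate_x3 e0 \<kappa>"
        by (simp add: Phi_map_def)
      then show ?thesis
        using y Psi_Phi_map[OF nz] by simp
    qed
    show "(Phi e0 e3 e4 \<kappa> \<circ>\<^sub>m total_on D F) x = (total_on ?Y H \<circ>\<^sub>m Phi e0 e3 e4 \<kappa>) x" if "x \<in> D" for x
      using that D_sub F[OF that] semi[OF that] Phi[of x]
      by (simp add: Phi_def map_comp_def subset_iff)
  qed simp
  finally show ?thesis
    by (simp add: map_comp_comp_assoc)
qed

section \<open>The conjugated braid dynamics\<close>

theorem proposition5p6:
  fixes e0 e3 e4 :: complex
  assumes "e0 \<noteq> 0" and "e3 \<noteq> 0" and "e4 \<noteq> 0"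
    and "e0 \<noteq> 1" and "e0 \<noteq> -1"
    and "e3 \<noteq> 1" and "e3 \<noteq> -1"
    and "e4 \<noteq> 1" and "e4 \<noteq> -1"
    and "\<forall>\<epsilon>3\<in>{1, -1::int}. \<forall>\<epsilon>4\<in>{1, -1::int}. e0 * e3 powi \<epsilon>3 * e4 powi \<epsilon>4 \<noteq> 1"
  defines "C \<equiv> cubic_V e0 e3 e4"
  shows
    "(\<forall>\<kappa>. \<kappa> \<noteq> 0 \<longrightarrow>
        birational_map C (cubic_VI e0 e3 e4 \<kappa>) (Phi e0 e3 e4 \<kappa>) \<and>
        birational_map C C (g_V e0 e3 e4 \<kappa> 1 2 3) \<and>
        birational_map C C (g_V e0 e3 e4 \<kappa> 2 3 1) \<and>
        birational_map C C (g_V e0 e3 e4 \<kappa> 3 1 2) \<and>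
        birational_map C C (X_rat e0 e3 e4 \<kappa>) \<and>
        rational_eq C (rat_inv C C (g_V e0 e3 e4 \<kappa> 2 3 1)) (X_rat e0 e3 e4 \<kappa>) \<and>
        rational_eq C (rat_inv C C (g_V e0 e3 e4 \<kappa> 3 1 2))
          (g_V e0 e3 e4 \<kappa> 1 2 3 \<circ>\<^sub>m g_V e0 e3 e4 \<kappa> 2 3 1)) \<and>
     (\<forall>\<kappa> \<kappa>'. \<kappa> \<noteq> 0 \<and> \<kappa>' \<noteq> 0 \<longrightarrow>
        rational_eq C (g_V e0 e3 e4 \<kappa> 1 2 3) (g_V e0 e3 e4 \<kappa>' 1 2 3))"
proof -
  let ?Phi = "Phi e0 e3 e4" and ?g = "g_V e0 e3 e4" and ?h = "h_VI e0 e3 e4"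
  let ?Y = "cubic_VI e0 e3 e4"
  let ?\<psi> = "\<lambda>\<kappa>. rat_inv C (?Y \<kappa>) (?Phi \<kappa>)"
  let ?s = "\<lambda>\<kappa> i j k. total_on (?Y \<kappa>) (vieta e0 e3 e4 \<kappa> i j k)"
  have Phi_birational: "birational_map C (?Y \<kappa>) (?Phi \<kappa>)" if "\<kappa> \<noteq> 0" for \<kappa>
    unfolding birational_map_def C_def
    using Phi_rational_inverse[OF \<open>e0 \<noteq> 0\<close> that] by blast
  note inv = rational_inverse_rat_inv[OF Phi_birational]
  have g_eq: "?g \<kappa> i j k = ?\<psi> \<kappa> \<circ>\<^sub>m ?h \<kappa> i j k \<circ>\<^sub>m ?Phi \<kappa>" for \<kappa> i j k
    by (simp add: g_V_def C_def)
  have g_inv: "rational_inverse C C (?g \<kappa> i j k)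
      (?\<psi> \<kappa> \<circ>\<^sub>m (?s \<kappa> j k i \<circ>\<^sub>m ?s \<kappa> i j k) \<circ>\<^sub>m ?Phi \<kappa>)"
    if "\<kappa> \<noteq> 0" "(i, j, k) \<in> {(1, 2, 3), (2, 3, 1), (3, 1, 2)}" for \<kappa> i j k
    unfolding g_eq by (rule conjugate_rational_inverse[OF inv[OF that(1)] h_VI_rational_inverse[OF that(2)]])
  then have g_birational: "birational_map C C (?g \<kappa> i j k)"
    if "\<kappa> \<noteq> 0" "(i, j, k) \<in> {(1, 2, 3), (2, 3, 1), (3, 1, 2)}" for \<kappa> i j k
    unfolding birational_map_def using that by blast
  have rat_inv_g: "rational_eq C (rat_inv C C (?g \<kappa> i j k))
      (?\<psi> \<kappa> \<circ>\<^sub>m (?s \<kappa> j k i \<circ>\<^sub>m ?s \<kappa> i j k) \<circ>\<^sub>m ?Phi \<kappa>)"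
    if "\<kappa> \<noteq> 0" "(i, j, k) \<in> {(1, 2, 3), (2, 3, 1), (3, 1, 2)}" for \<kappa> i j k
    using rational_inverse_unique[OF rational_inverse_rat_inv[OF g_birational[OF that]] g_inv[OF that]] .

  have X: "rational_eq C (rat_inv C C (?g \<kappa> 2 3 1)) (X_rat e0 e3 e4 \<kappa>)" if "\<kappa> \<noteq> 0" for \<kappa>
  proof -
    have s: "?s \<kappa> 3 1 2 \<circ>\<^sub>m ?s \<kappa> 2 3 1 =
        total_on (?Y \<kappa>) (\<lambda>y. vieta e0 e3 e4 \<kappa> 3 1 2 (vieta e0 e3 e4 \<kappa> 2 3 1 y))"
      by (rule total_on_comp) (simp add: vieta_cubic_VI)
    have "rational_eq C (?\<psi> \<kappa> \<circ>\<^sub>m (?s \<kappa> 3 1 2 \<circ>\<^sub>m ?s \<kappa> 2 3 1) \<circ>\<^sub>m ?Phi \<kappa>) (X_rat e0 e3 e4 \<kappa>)"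
      unfolding X_rat_def s C_def
    proof (rule conjugate_Phi_eqI)
      show "rational_inverse (cubic_V e0 e3 e4) (?Y \<kappa>) (?Phi \<kappa>) (rat_inv (cubic_V e0 e3 e4) (?Y \<kappa>) (?Phi \<kappa>))"
        using inv[OF that] by (simp add: C_def)
      show "rational_inverse (?Y \<kappa>) (?Y \<kappa>)
          (total_on (?Y \<kappa>) (\<lambda>y. vieta e0 e3 e4 \<kappa> 3 1 2 (vieta e0 e3 e4 \<kappa> 2 3 1 y))) (?h \<kappa> 2 3 1)"
        unfolding s[symmetric] by (rule rational_inverse_sym[OF h_VI_rational_inverse]) simp
    qed (use that \<open>e0 \<noteq> 0\<close> in
        \<open>auto simp: zariski_dense_open_cubic_V X_map_cubic_V Phi_X_map\<close>)
    with rat_inv_g[OF that, of 2 3 1] show ?thesis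
      using rational_eq_trans by auto
  qed

  have X_birational: "birational_map C C (X_rat e0 e3 e4 \<kappa>)" if "\<kappa> \<noteq> 0" for \<kappa>
  proof -
    have "rational_map C C (X_rat e0 e3 e4 \<kappa>)"
      unfolding X_rat_def C_def
      using that \<open>e0 \<noteq> 0\<close> by (intro rational_map_total_on regular_on_X_map)
        (auto simp: zariski_dense_open_cubic_V X_map_cubic_V)
    moreover have "rational_inverse C C (rat_inv C C (?g \<kappa> 2 3 1)) (?g \<kappa> 2 3 1)"
      using that by (intro rational_inverse_sym[OF rational_inverse_rat_inv] g_birational) auto
    ultimately show ?thesis
      unfolding birational_map_def using rational_inverse_cong X[OF that] by blast
  qed

  have g31: "rational_eq C (rat_inv C C (?g \<kappa> 3 1 2)) (?g \<kappa> 1 2 3 \<circ>\<^sub>m ?g \<kappa> 2 3 1)"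
    if "\<kappa> \<noteq> 0" for \<kappa>
  proof -
    have "rational_eq C (rat_inv C C (?g \<kappa> 3 1 2)) (?\<psi> \<kappa> \<circ>\<^sub>m (?h \<kappa> 1 2 3 \<circ>\<^sub>m ?h \<kappa> 2 3 1) \<circ>\<^sub>m ?Phi \<kappa>)"
      using rat_inv_g[OF that, of 3 1 2] by (simp add: h_VI_comp_h_VI)
    also have "rational_eq C \<dots> (?g \<kappa> 1 2 3 \<circ>\<^sub>m ?g \<kappa> 2 3 1)"
      unfolding g_eq
      by (rule rational_eq_sym, rule conjugate_comp[OF inv[OF that] h_VI_rational_inverse h_VI_rational_inverse])
        auto
    finally show ?thesis .
  qed

  have g12: "rational_eq C (?g \<kappa> 1 2 3) (total_on C (vieta_V_map e0 e3 e4))" if "\<kappa> \<noteq> 0" for \<kappa>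
    unfolding g_V_def h_VI_def C_def
  proof (rule conjugate_Phi_eqI)
    show "rational_inverse (cubic_V e0 e3 e4) (?Y \<kappa>) (?Phi \<kappa>) (rat_inv (cubic_V e0 e3 e4) (?Y \<kappa>) (?Phi \<kappa>))"
      using inv[OF that] by (simp add: C_def)
    show "rational_inverse (?Y \<kappa>) (?Y \<kappa>) (total_on (?Y \<kappa>) (h_map e0 e3 e4 \<kappa> 1 2 3))
        (?s \<kappa> 2 3 1 \<circ>\<^sub>m ?s \<kappa> 1 2 3)"
      unfolding h_VI_def[symmetric] by (rule h_VI_rational_inverse) simp
  qed (use that \<open>e0 \<noteq> 0\<close> in \<open>auto simp: zariski_dense_open_self vieta_V_map_cubic_V Phi_vieta_V_map\<close>)
  have g12_indep: "rational_eq C (?g \<kappa> 1 2 3) (?g \<kappa>' 1 2 3)" if "\<kappa> \<noteq> 0" "\<kappa>' \<noteq> 0" for \<kappa> \<kappa>'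
    using g12[OF that(1)] rational_eq_sym[OF g12[OF that(2)]] by (rule rational_eq_trans)
  show ?thesis
    using Phi_birational g_birational X_birational X g31 g12_indep by auto
qed

end
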